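(* Let $m$ be a positive integer. For any set $S$ of $2m+9$ points in the plane in general position, it is possible to divide the plane into three disjoint convex regions such that one of them contains exactly $9$ points of $S$, these $9$ points forming a set which contains a $5$-hole, and each of the other two regions contains exactly $m$ points of $S$.
   Context: A finite set of points in the plane is in general position if no three of its points lie on a line. For a finite point set $T$ in the plane in general position, a $k$-hole (empty convex $k$-gon) of $T$ is a subset of $k$ points of $T$ which are the vertices of a convex $k$-gon whose interior contains no points of $T$; $T$ is said to contain a $k$-hole if such a subset exists. *)

theory Defs
  imports "HOL-Analysis.Analysis"
begin

definition general_position :: "(real^2) set \<Rightarrow> bool" where
  "general_position S \<longleftrightarrow> finite S \<and> (\<forall>T\<subseteq>S. card T = 3 \<longrightarrow> \<not> collinear T)"

(* The third conjunct says that the points of H are precisely the vertices of the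
   convex polygon that they span.  Points of T on its boundary need not be excluded
   separately: for T in general position only the vertices themselves lie there. *)
definition is_hole :: "nat \<Rightarrow> (real^2) set \<Rightarrow> (real^2) set \<Rightarrow> bool" where
  "is_hole k T H \<longleftrightarrow>
     H \<subseteq> T \<and> card H = k \<and>
     {v. v extreme_point_of (convex hull H)} = H \<and>
     interior (convex hull H) \<inter> T = {}"

definition contains_hole :: "nat \<Rightarrow> (real^2) set \<Rightarrow> bool" where
  "contains_hole k T \<longleftrightarrow> (\<exists>H. is_hole k T H)"

(* A region may include any part of its boundary, so that the plane can be an exact
   disjoint union of regions, but it may not degenerate to a point, segment or line. *)
definition convex_region :: "(real^2) set \<Rightarrow> bool" where
  "convex_region R \<longleftrightarrow> convex R \<and> interior R \<noteq> {}"

end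

theory Submission
  imports Defs
begin

text \<open>
The points are found by two straight cuts. A first line through a vertex of the convex hull of
\<open>S\<close> cuts off \<open>m\<close> points; the other \<open>m + 9\<close> points, at least ten, are then handled by
the following stronger fact (lemma \<open>nine_cut\<close>): in any set of at least ten points in general
position, some line has exactly nine of the points on one side, and these nine contain a 5-hole.
The half-plane beyond the first line and the two parts into which the second line divides the
other half-plane are the three regions.

For the second cut, sort the points counterclockwise around a hull vertex as \<open>p 0, p 1, p 2, \<dots>\<close>
with \<open>p 0\<close> the vertex itself, and let \<open>D\<close> consist of \<open>p 0, \<dots>, p 7\<close> and \<open>C\<close> of all other points.
Three sets of nine points can be cut off by a line:
\<^item> \<open>p 1, \<dots>, p 9\<close>, by turning the line through \<open>p 0\<close> and \<open>p 9\<close> slightly;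
\<^item> \<open>D \<union> {p j}\<close>, where \<open>p j\<close> is the point of \<open>C\<close> on an inner common tangent of \<open>D\<close> and \<open>C\<close>;
\<^item> \<open>D \<union> {p j, p c} - {p b}\<close>, where the line through \<open>p b\<close> and \<open>p c\<close> is an inner common tangent of
  \<open>D \<union> {p j}\<close> and \<open>C - {p j}\<close>. One sees that \<open>b\<close> is one of \<open>1, \<dots>, 7\<close>.

One of these three sets contains a 5-hole. Whether it does depends only on the orientations of the
triples taken from the at most twelve points \<open>p 0, \<dots>, p 9, p j, p c\<close>, and the orientations of points
sorted around an extreme point obey a simple law: they form a signotope, that is, along the four
triples of any four indices, in lexicographic order, the sign changes at most once
(\<open>monotone4_ccw\<close>). The absence of a 5-hole is a statement about these signs as well
(\<open>obstructed_if_no_hole\<close>). So the claim becomes a propositional one about finitely many signs. It is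
split into five configurations, according to the places of \<open>p j\<close> and \<open>p c\<close> in the angular order and
to whether the tangent touches \<open>D\<close> at its outermost point \<open>p 1\<close>; each of the five is refuted by
resolution.
\<close>

section \<open>Orientation\<close>

definition ori :: "real^2 \<Rightarrow> real^2 \<Rightarrow> real^2 \<Rightarrow> real" where
  "ori a b c = (b$1 - a$1) * (c$2 - a$2) - (b$2 - a$2) * (c$1 - a$1)"

lemma ori_rotate: "ori b c a = ori a b c"
  by (simp add: ori_def algebra_simps)

lemma ori_swap: "ori a c b = - ori a b c" "ori b a c = - ori a b c" "ori c b a = - ori a b c"
  by (simp_all add: ori_def algebra_simps)

lemma ori_degenerate [simp]: "ori a a b = 0" "ori a b a = 0" "ori a b b = 0"
  by (simp_all add: ori_def)

lemma ori_eq_0_imp_collinear: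
  assumes "ori a b c = 0"
  shows "collinear {a, b, c}"
proof (cases "a = c")
  case False
  define u where "u = (if a$1 \<noteq> c$1 then (b$1 - c$1) / (a$1 - c$1) else (b$2 - c$2) / (a$2 - c$2))"
  have d: "a$1 \<noteq> c$1 \<or> a$2 \<noteq> c$2"
    using False by (auto simp: vec_eq_iff forall_2)
  have e: "(b$1 - c$1) * (a$2 - c$2) = (b$2 - c$2) * (a$1 - c$1)"
    using assms by (simp add: ori_def algebra_simps)
  have "b$1 = u * a$1 + (1 - u) * c$1 \<and> b$2 = u * a$2 + (1 - u) * c$2"
  proof (cases "a$1 = c$1")
    case True
    then have nz: "a$2 - c$2 \<noteq> 0" and u: "u * (a$2 - c$2) = b$2 - c$2" and "b$1 = c$1"
      using d e by (auto simp: u_def)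
    then show ?thesis using True by (simp add: algebra_simps)
  next
    case F: False
    then have u: "u * (a$1 - c$1) = b$1 - c$1" by (simp add: u_def)
    have "u * (a$2 - c$2) * (a$1 - c$1) = (u * (a$1 - c$1)) * (a$2 - c$2)" by simp
    also have "\<dots> = (b$2 - c$2) * (a$1 - c$1)" using u e by simp
    finally have "u * (a$2 - c$2) * (a$1 - c$1) = (b$2 - c$2) * (a$1 - c$1)" .
    then have "u * (a$2 - c$2) = b$2 - c$2" using F by simp
    then show ?thesis using u by (simp add: algebra_simps)
  qed
  then have "b = u *\<^sub>R a + (1 - u) *\<^sub>R c"
    by (simp add: vec_eq_iff forall_2)
  then show ?thesis unfolding collinear_3_expand by blast
qed (simp add: collinear_3_expand insert_commute)

lemma general_position_ori:
  assumes "general_position S" "a \<in> S" "b \<in> S" "c \<in> S" "a \<noteq> b" "b \<noteq> c" "a \<noteq> c"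
  shows "ori a b c \<noteq> 0"
proof
  assume "ori a b c = 0"
  then have "collinear {a, b, c}" by (rule ori_eq_0_imp_collinear)
  moreover have "card {a, b, c} = 3" using assms by auto
  ultimately show False using assms unfolding general_position_def
    by (metis empty_subsetI insert_subset)
qed

lemma general_position_subset: "general_position S \<Longrightarrow> T \<subseteq> S \<Longrightarrow> general_position T"
  unfolding general_position_def by (meson finite_subset order_trans)

section \<open>Empty pentagons from orientations\<close>

definition in_triangle :: "real^2 \<Rightarrow> real^2 \<Rightarrow> real^2 \<Rightarrow> real^2 \<Rightarrow> bool" where
  "in_triangle t a b c \<longleftrightarrow> ori a b t > 0 \<and> ori b c t > 0 \<and> ori c a t > 0"

lemma convex_hull_triangle_imp_in_triangle:
  assumes gp: "general_position (insert t {a, b, c})" and nt: "t \<notin> {a, b, c}"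
    and dist: "a \<noteq> b" "b \<noteq> c" "a \<noteq> c" and t: "t \<in> convex hull {a, b, c}"
  shows "in_triangle t a b c \<or> in_triangle t a c b"
proof -
  obtain u v w where uvw: "0 \<le> u" "0 \<le> v" "0 \<le> w" "u + v + w = 1"
      "t = u *\<^sub>R a + v *\<^sub>R b + w *\<^sub>R c"
    using t unfolding convex_hull_3 by auto
  have w: "w = 1 - u - v" using uvw by simp
  have eq: "ori a b t = w * ori a b c" "ori b c t = u * ori a b c" "ori c a t = v * ori a b c"
    unfolding uvw(5) w by (simp_all add: ori_def algebra_simps)
  have "ori a b t \<noteq> 0" "ori b c t \<noteq> 0" "ori c a t \<noteq> 0"
    using general_position_ori[OF gp] nt dist by auto
  then have "u > 0" "v > 0" "w > 0" "ori a b c \<noteq> 0" using eq uvw by (auto simp: less_le)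
  then have "0 < ori a b c \<and> in_triangle t a b c \<or> ori a b c < 0 \<and> in_triangle t a c b"
    unfolding in_triangle_def ori_swap(2)[of a c t] ori_swap(2)[of c b t] ori_swap(2)[of b a t] eq
    by (auto simp: zero_less_mult_iff mult_less_0_iff neq_iff)
  then show ?thesis by blast
qed

lemma convex_hull_imp_in_triangle:
  assumes gp: "general_position (insert t H)" and nt: "t \<notin> H" and card: "card H \<ge> 3"
    and t: "t \<in> convex hull H"
  shows "\<exists>a\<in>H. \<exists>b\<in>H. \<exists>c\<in>H. a \<noteq> b \<and> b \<noteq> c \<and> a \<noteq> c \<and> in_triangle t a b c"
proof -
  have finH: "finite H" using card by (metis card.infinite not_numeral_le_zero)
  obtain F where F: "finite F" "F \<subseteq> H" "card F \<le> 3" "t \<in> convex hull F"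
    using t unfolding caratheodory[of H] by auto
  obtain G where G: "F \<subseteq> G" "G \<subseteq> H" "card G = 3"
    using F card finH by (metis exists_subset_between)
  then obtain a b c where abc: "G = {a, b, c}" "a \<noteq> b" "b \<noteq> c" "a \<noteq> c"
    by (metis card_3_iff)
  have hull: "t \<in> convex hull {a, b, c}" using F(4) G(1) hull_mono abc(1) by blast
  have sub: "a \<in> H" "b \<in> H" "c \<in> H" using G(2) abc(1) by auto
  have gp': "general_position (insert t {a, b, c})"
    by (rule general_position_subset[OF gp]) (use sub in auto)
  have "t \<notin> {a, b, c}" using nt sub by auto
  from convex_hull_triangle_imp_in_triangle[OF gp' this abc(2-4) hull]
  show ?thesis
  proof
    assume "in_triangle t a b c"
    then show ?thesis using sub abc(2-4) by (intro bexI[of _ a] bexI[of _ b] bexI[of _ c]) auto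
  next
    assume "in_triangle t a c b"
    then show ?thesis using sub abc(2-4) by (intro bexI[of _ a] bexI[of _ c] bexI[of _ b]) auto
  qed
qed

text \<open>
By Caratheodory's theorem a point of the plane lies in the convex hull of a set only if it lies in
a triangle spanned by the set. Hence a convexity test on all triangles settles both that the points
of \<open>H\<close> are vertices and that no point of \<open>T\<close> is inside: the vertices themselves are allowed as
\<open>t\<close>.
\<close>
lemma is_hole_if_no_in_triangle:
  assumes gp: "general_position T" and H: "H \<subseteq> T" "card H = k" "k \<ge> 4"
    and no: "\<And>t a b c. \<lbrakk>t \<in> T; a \<in> H; b \<in> H; c \<in> H\<rbrakk> \<Longrightarrow> \<not> in_triangle t a b c"
  shows "is_hole k T H"
proof -
  have fin: "finite H" using H by (metis card.infinite not_numeral_le_zero)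
  have out: "t \<notin> convex hull (H - {t})" if "t \<in> T" for t
  proof
    assume "t \<in> convex hull (H - {t})"
    moreover have "card (H - {t}) \<ge> 3" using H fin by (simp add: card_Diff_singleton_if) arith
    moreover have "general_position (insert t (H - {t}))"
      by (rule general_position_subset[OF gp]) (use H that in auto)
    ultimately show False
      using convex_hull_imp_in_triangle[of t "H - {t}"] no[OF that] by blast
  qed
  have ext: "v extreme_point_of convex hull H \<longleftrightarrow> v \<in> H" for v
    using extreme_point_of_convex_hull_convex_independent[of H v] out H(1) fin
    by (auto simp: finite_imp_compact)
  have "t \<notin> interior (convex hull H)" if "t \<in> T" for t
  proof (cases "t \<in> H")
    case True
    then show ?thesis using ext extreme_point_not_in_interior by blast
  next
    case False
    then show ?thesis using out[OF that] interior_subset by fastforce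
  qed
  then show ?thesis using ext H unfolding is_hole_def by blast
qed

section \<open>Cuts\<close>

definition separable :: "(real^2) set \<Rightarrow> (real^2) set \<Rightarrow> bool" where
  "separable A B \<longleftrightarrow> (\<exists>v t. (\<forall>x\<in>A. v \<bullet> x > t) \<and> (\<forall>x\<in>B. v \<bullet> x < t))"

text \<open>
A line that has some of the points on it still separates if those points can be told apart by a
second linear functional: adding a small multiple of that functional moves the line off the points,
and since there are only finitely many points, none of the others changes sides.
\<close>
lemma separable_perturb:
  assumes fin: "finite A" "finite B"
    and A: "\<And>x. x \<in> A \<Longrightarrow> ori p q x > 0 \<or> ori p q x = 0 \<and> g \<bullet> x > s"
    and B: "\<And>x. x \<in> B \<Longrightarrow> ori p q x < 0 \<or> ori p q x = 0 \<and> g \<bullet> x < s"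
  shows "separable A B"
proof -
  \<comment> \<open>The normal vector of the line through \<open>p\<close> and \<open>q\<close>.\<close>
  define w :: "real^2" where "w = (\<chi> i. if i = 1 then p$2 - q$2 else q$1 - p$1)"
  have w: "ori p q x = w \<bullet> x - w \<bullet> p" for x
    by (simp add: w_def ori_def inner_vec_def sum_2 algebra_simps)
  have lim: "((\<lambda>e. (w \<bullet> x - w \<bullet> p) + e * (g \<bullet> x - s)) \<longlongrightarrow> (w \<bullet> x - w \<bullet> p) + 0 * (g \<bullet> x - s)) (at_right 0)" for x
    by (intro tendsto_intros)
  have pos: "\<forall>\<^sub>F e in at_right 0. e > (0::real)" by (simp add: eventually_at_right_less)
  have eA: "\<forall>\<^sub>F e in at_right 0. (w \<bullet> x - w \<bullet> p) + e * (g \<bullet> x - s) > 0" if "x \<in> A" for x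
  proof (cases "ori p q x > 0")
    case True
    then show ?thesis using order_tendstoD(1)[OF lim, of 0 x] w by simp
  next
    case False
    then have "ori p q x = 0" "g \<bullet> x > s" using A that by auto
    then show ?thesis using pos w by (auto elim!: eventually_mono)
  qed
  have eB: "\<forall>\<^sub>F e in at_right 0. (w \<bullet> x - w \<bullet> p) + e * (g \<bullet> x - s) < 0" if "x \<in> B" for x
  proof (cases "ori p q x < 0")
    case True
    then show ?thesis using order_tendstoD(2)[OF lim, of x 0] w by simp
  next
    case False
    then have "ori p q x = 0" "g \<bullet> x < s" using B that by auto
    then show ?thesis using pos w by (auto elim!: eventually_mono simp: mult_pos_neg)
  qed
  have "\<forall>\<^sub>F e in at_right 0. (\<forall>x\<in>A. (w \<bullet> x - w \<bullet> p) + e * (g \<bullet> x - s) > 0) \<and>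
      (\<forall>x\<in>B. (w \<bullet> x - w \<bullet> p) + e * (g \<bullet> x - s) < 0)"
    using eA eB fin by (auto simp: eventually_conj_iff eventually_ball_finite)
  then obtain e where e: "\<forall>x\<in>A. (w \<bullet> x - w \<bullet> p) + e * (g \<bullet> x - s) > 0"
      "\<forall>x\<in>B. (w \<bullet> x - w \<bullet> p) + e * (g \<bullet> x - s) < 0"
    using eventually_happens'[OF trivial_limit_at_right_real] by blast
  show ?thesis unfolding separable_def
    by (intro exI[of _ "w + e *\<^sub>R g"] exI[of _ "w \<bullet> p + e * s"])
      (use e in \<open>auto simp: inner_add_left algebra_simps\<close>)
qed

lemma separable_line_split:
  assumes "finite A" "finite B" and ab: "a \<noteq> b" "ori p q a = 0" "ori p q b = 0"
    and A: "\<And>x. x \<in> A - {a} \<Longrightarrow> ori p q x > 0" "b \<notin> A"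
    and B: "\<And>x. x \<in> B - {b} \<Longrightarrow> ori p q x < 0" "a \<notin> B"
  shows "separable A B"
  \<comment> \<open>The second functional vanishes at the midpoint of \<open>a\<close> and \<open>b\<close>: the line turns about it.\<close>
proof (rule separable_perturb[where p = p and q = q and g = "a - b" and s = "((a - b) \<bullet> (a + b)) / 2"])
  have pos: "(a - b) \<bullet> (a - b) > 0" using ab(1) by simp
  then have 1: "(a - b) \<bullet> a > ((a - b) \<bullet> (a + b)) / 2" and 2: "(a - b) \<bullet> b < ((a - b) \<bullet> (a + b)) / 2"
    by (simp_all add: inner_diff_right inner_add_right)
  show "ori p q x > 0 \<or> ori p q x = 0 \<and> (a - b) \<bullet> x > ((a - b) \<bullet> (a + b)) / 2" if "x \<in> A" for x
    using A(1)[of x] that 1 ab by (cases "x = a") auto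
  show "ori p q x < 0 \<or> ori p q x = 0 \<and> (a - b) \<bullet> x < ((a - b) \<bullet> (a + b)) / 2" if "x \<in> B" for x
    using B(1)[of x] that 2 ab by (cases "x = b") auto
qed (use assms in auto)

lemma separable_line_left:
  assumes "finite A" "finite B"
    and "\<And>x. x \<in> A - {p, q} \<Longrightarrow> ori p q x > 0" and "\<And>x. x \<in> B \<Longrightarrow> ori p q x < 0"
  shows "separable A B"
proof (rule separable_perturb[where p = p and q = q and g = 0 and s = "-1"])
  show "ori p q x > 0 \<or> ori p q x = 0 \<and> 0 \<bullet> x > (-1::real)" if "x \<in> A" for x
    using assms(3)[of x] that by (cases "x = p \<or> x = q") auto
qed (use assms in auto)

section \<open>Inner tangents\<close>

text \<open>
Relative to a separating line, the inner common tangent is the line of extreme slope among all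
lines that join a point of one set to a point of the other. The denominators of the slopes have
constant sign because the line separates the sets.
\<close>
lemma inner_tangent:
  assumes gp: "general_position (A \<union> C)" and ne: "A \<noteq> {}" "C \<noteq> {}" and separable: "separable A C"
  shows "\<exists>b\<in>A. \<exists>c\<in>C. (\<forall>x\<in>A - {b}. ori b c x > 0) \<and> (\<forall>y\<in>C - {c}. ori b c y < 0)"
proof -
  obtain v t where v: "\<And>x. x \<in> A \<Longrightarrow> v \<bullet> x > t" "\<And>x. x \<in> C \<Longrightarrow> v \<bullet> x < t"
    using separable unfolding separable_def by blast
  \<comment> \<open>\<open>e\<close> is \<open>v\<close> turned by a right angle: slopes are measured along the separating line.\<close>
  define e :: "real^2" where "e = (\<chi> i. if i = 1 then - v$2 else v$1)"
  define slope where "slope = (\<lambda>(b, c). (e \<bullet> b - e \<bullet> c) / (v \<bullet> b - v \<bullet> c))"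
  have fin: "finite A" "finite C" using gp by (auto simp: general_position_def)
  have dj: "A \<inter> C = {}" using v by force
  obtain bc where bc: "bc \<in> A \<times> C" and mx: "\<And>z. z \<in> A \<times> C \<Longrightarrow> slope z \<le> slope bc"
  proof -
    have "finite (slope ` (A \<times> C))" "slope ` (A \<times> C) \<noteq> {}" using fin ne by auto
    then have "Max (slope ` (A \<times> C)) \<in> slope ` (A \<times> C)"
      and "\<And>z. z \<in> A \<times> C \<Longrightarrow> slope z \<le> Max (slope ` (A \<times> C))"
      by (auto intro: Max_in Max_ge simp del: Max_less_iff)
    then show ?thesis using that by (metis (no_types, lifting) imageE)
  qed
  obtain b c where b: "b \<in> A" and c: "c \<in> C" and bceq: "bc = (b, c)" using bc by auto
  have vv: "v \<bullet> v > 0" using v(1)[OF b] v(2)[OF c] by (cases "v = 0") auto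
  have cross: "(e \<bullet> p - e \<bullet> q) * (v \<bullet> r - v \<bullet> s) - (e \<bullet> r - e \<bullet> s) * (v \<bullet> p - v \<bullet> q) =
      (v \<bullet> v) * ((p$2 - q$2) * (r$1 - s$1) - (p$1 - q$1) * (r$2 - s$2))" for p q r s
    by (simp add: e_def inner_vec_def sum_2 algebra_simps)
  have le: "(e \<bullet> x - e \<bullet> y) * (v \<bullet> b - v \<bullet> c) - (e \<bullet> b - e \<bullet> c) * (v \<bullet> x - v \<bullet> y) \<le> 0"
    if "x \<in> A" "y \<in> C" for x y
  proof -
    have "v \<bullet> x - v \<bullet> y > 0" "v \<bullet> b - v \<bullet> c > 0" using v that b c by force+
    then show ?thesis using mx[of "(x, y)"] that unfolding bceq slope_def
      by (simp add: frac_le_eq divide_simps algebra_simps)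
  qed
  have "ori b c x > 0" if x: "x \<in> A - {b}" for x
  proof -
    have "0 \<le> (v \<bullet> v) * ori b c x"
      using le[of x c] x c cross[of x c b c] by (simp add: ori_def algebra_simps)
    then have "ori b c x \<ge> 0" using vv by (simp add: zero_le_mult_iff)
    moreover have "ori b c x \<noteq> 0"
      using general_position_ori[OF gp, of b c x] x b c dj by auto
    ultimately show ?thesis by simp
  qed
  moreover have "ori b c y < 0" if y: "y \<in> C - {c}" for y
  proof -
    have "(v \<bullet> v) * (ori b c y) \<le> 0"
      using le[of b y] y b cross[of b y b c] by (simp add: ori_def algebra_simps)
    then have "ori b c y \<le> 0" using vv by (simp add: mult_le_0_iff)
    moreover have "ori b c y \<noteq> 0"
      using general_position_ori[OF gp, of b c y] y b c dj by auto
    ultimately show ?thesis by simp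
  qed
  ultimately show ?thesis using b c by blast
qed

section \<open>Signotopes\<close>

text \<open>
The truth values stand for signs. The condition holds whenever the quantity with sign \<open>q\<close> is a
combination of those with signs \<open>p\<close> and \<open>r\<close> whose coefficients are nonnegative and not both zero.
\<close>
definition sign_between :: "bool \<Rightarrow> bool \<Rightarrow> bool \<Rightarrow> bool" where
  "sign_between p q r \<longleftrightarrow> (p \<and> r \<longrightarrow> q) \<and> (q \<longrightarrow> p \<or> r)"

text \<open>
Equivalently, the sequence \<open>s a b c, s a b d, s a c d, s b c d\<close> changes its value at most once.
This is the axiom of a signotope of rank three.
\<close>
definition monotone4 :: "(nat \<Rightarrow> nat \<Rightarrow> nat \<Rightarrow> bool) \<Rightarrow> nat \<Rightarrow> nat \<Rightarrow> nat \<Rightarrow> nat \<Rightarrow> bool" where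
  "monotone4 s a b c d \<longleftrightarrow>
     sign_between (s a b c) (s a b d) (s a c d) \<and> sign_between (s a b c) (s a b d) (s b c d) \<and>
     sign_between (s a b c) (s a c d) (s b c d) \<and> sign_between (s a b d) (s a c d) (s b c d)"

text \<open>
If \<open>s\<close> gives the orientations of sorted points, this says that point \<open>t\<close> lies inside the triangle
of the points \<open>a < b < c\<close>. Usually three signs have to be compared for that, but since signs change
only once along four indices, a single disagreement decides: for \<open>a < t < b\<close>, the inequality
\<open>s a t b \<noteq> s a t c\<close> already forces the remaining signs.
\<close>
definition surrounded :: "(nat \<Rightarrow> nat \<Rightarrow> nat \<Rightarrow> bool) \<Rightarrow> nat \<Rightarrow> nat \<Rightarrow> nat \<Rightarrow> nat \<Rightarrow> bool" where
  "surrounded s t a b c \<longleftrightarrow> a < b \<and> b < c \<and>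
     (a < t \<and> t < b \<and> s a t b \<noteq> s a t c \<or> b < t \<and> t < c \<and> s a t c \<noteq> s b t c)"

text \<open>
Why \<open>a < b < c < d < e\<close> are not the vertices of an empty pentagon. It is enough to look at the six
triangles with apex \<open>a\<close>: they cover every convex pentagon, and they also witness every failure of
convexity, because \<open>t\<close> may be one of \<open>b, c, d, e\<close>.
\<close>
definition obstructed ::
  "(nat \<Rightarrow> nat \<Rightarrow> nat \<Rightarrow> bool) \<Rightarrow> nat list \<Rightarrow> nat \<Rightarrow> nat \<Rightarrow> nat \<Rightarrow> nat \<Rightarrow> nat \<Rightarrow> bool" where
  "obstructed s U a b c d e \<longleftrightarrow> list_ex (\<lambda>t.
     surrounded s t a b c \<or> surrounded s t a b d \<or> surrounded s t a b e \<or>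
     surrounded s t a c d \<or> surrounded s t a c e \<or> surrounded s t a d e) U"

lemma obstructed_mono: "obstructed s U a b c d e \<Longrightarrow> set U \<subseteq> set V \<Longrightarrow> obstructed s V a b c d e"
  unfolding obstructed_def list_ex_iff by blast

text \<open>
Triangles without the apex \<open>a\<close> bring nothing new: if \<open>a, i, j, k\<close> are in convex position, the
triangle \<open>i j k\<close> is covered by the three triangles with apex \<open>a\<close>, and otherwise \<open>i\<close> or \<open>j\<close> lies in
the triangle of the other three points.
\<close>
lemma surrounded_via_apex:
  assumes m: "\<And>x y z w. \<lbrakk>{x, y, z, w} \<subseteq> {a, i, j, k, t}; x < y; y < z; z < w\<rbrakk> \<Longrightarrow> monotone4 s x y z w"
    and "a < i" and inn: "surrounded s t i j k"
  shows "surrounded s i a j k \<or> surrounded s j a i k \<or> surrounded s t a i j \<or> surrounded s t a i k \<or> surrounded s t a j k"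
proof -
  have ijk: "i < j" "j < k" using inn by (auto simp: surrounded_def)
  consider "i < t" "t < j" "s i t j \<noteq> s i t k" | "j < t" "t < k" "s i t k \<noteq> s j t k"
    using inn by (auto simp: surrounded_def)
  then show ?thesis
  proof cases
    case 1
    have "monotone4 s a i t j" "monotone4 s a i t k" "monotone4 s a t j k" "monotone4 s i t j k"
        "monotone4 s a i j k"
      using 1 ijk \<open>a < i\<close> by (auto intro!: m)
    moreover have "surrounded s i a j k \<longleftrightarrow> s a i j \<noteq> s a i k" "surrounded s j a i k \<longleftrightarrow> s a j k \<noteq> s i j k"
        "surrounded s t a i j \<longleftrightarrow> s a t j \<noteq> s i t j" "surrounded s t a i k \<longleftrightarrow> s a t k \<noteq> s i t k"
        "surrounded s t a j k \<longleftrightarrow> s a t j \<noteq> s a t k"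
      using 1 ijk \<open>a < i\<close> by (auto simp: surrounded_def)
    ultimately show ?thesis using 1(3) unfolding monotone4_def sign_between_def by sat
  next
    case 2
    have "monotone4 s a i j t" "monotone4 s a i t k" "monotone4 s a j t k" "monotone4 s i j t k"
        "monotone4 s a i j k"
      using 2 ijk \<open>a < i\<close> by (auto intro!: m)
    moreover have "surrounded s i a j k \<longleftrightarrow> s a i j \<noteq> s a i k" "surrounded s j a i k \<longleftrightarrow> s a j k \<noteq> s i j k"
        "surrounded s t a i k \<longleftrightarrow> s a t k \<noteq> s i t k" "surrounded s t a j k \<longleftrightarrow> s a t k \<noteq> s j t k"
      using 2 ijk \<open>a < i\<close> by (auto simp: surrounded_def)
    ultimately show ?thesis using 2(3) unfolding monotone4_def sign_between_def by sat
  qed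
qed

section \<open>Orientation of points sorted around an extreme point\<close>

text \<open>
The inequality is weak so that a sequence of points whose last two entries coincide is covered too;
then the degenerate triples count as positive.
\<close>
definition ccw :: "(nat \<Rightarrow> real^2) \<Rightarrow> nat \<Rightarrow> nat \<Rightarrow> nat \<Rightarrow> bool" where
  "ccw p i j k \<longleftrightarrow> 0 \<le> ori (p i) (p j) (p k)"

lemma sign_between_combination:
  fixes x y z :: real
  assumes "\<alpha> * y = \<beta> * x + \<gamma> * z" "\<alpha> > 0" "\<beta> > 0" "\<gamma> \<ge> 0"
  shows "sign_between (0 \<le> x) (0 \<le> y) (0 \<le> z)" "sign_between (0 \<le> z) (0 \<le> y) (0 \<le> x)"
proof -
  have "0 \<le> y" if "0 \<le> x" "0 \<le> z"
  proof -
    have "0 \<le> \<alpha> * y" using assms that by simp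
    then show ?thesis using assms(2) by (simp add: zero_le_mult_iff)
  qed
  moreover have "y < 0" if "x < 0" "z < 0"
  proof -
    have "\<beta> * x < 0" "\<gamma> * z \<le> 0" using assms that by (simp_all add: mult_pos_neg mult_nonneg_nonpos)
    then have "\<alpha> * y < 0" using assms(1) by simp
    then show ?thesis using assms(2) by (simp add: mult_less_0_iff)
  qed
  ultimately show "sign_between (0 \<le> x) (0 \<le> y) (0 \<le> z)" "sign_between (0 \<le> z) (0 \<le> y) (0 \<le> x)"
    unfolding sign_between_def by force+
qed

text \<open>
Around a point \<open>u\<close> that sees \<open>a, b, c, d\<close> in counterclockwise order, the Grassmann-Pluecker
relations express each middle orientation as a combination of the outer two, with coefficients that
are themselves orientations of triples at \<open>u\<close> and hence nonnegative. The last two points may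
coincide.
\<close>
lemma monotone4_ccw:
  assumes "ori u (p a) (p b) > 0" "ori u (p a) (p c) > 0" "ori u (p a) (p d) > 0"
    and "ori u (p b) (p c) > 0" "ori u (p b) (p d) > 0" "ori u (p c) (p d) \<ge> 0"
  shows "monotone4 (ccw p) a b c d"
proof -
  let ?o = "\<lambda>i j. ori u (p i) (p j)" and ?t = "\<lambda>i j k. ori (p i) (p j) (p k)"
  have 1: "?o a c * ?t a b d = ?o a d * ?t a b c + ?o a b * ?t a c d"
    and 2: "?o b c * ?t a b d = ?o b d * ?t a b c + ?o a b * ?t b c d"
    and 3: "?o b c * ?t a c d = ?o a c * ?t b c d + ?o c d * ?t a b c"
    and 4: "?o b d * ?t a c d = ?o a d * ?t b c d + ?o c d * ?t a b d"
    by (simp_all add: ori_def algebra_simps)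
  show ?thesis unfolding monotone4_def ccw_def
    using sign_between_combination[OF 1] sign_between_combination[OF 2] sign_between_combination[OF 3]
      sign_between_combination[OF 4] assms by simp
qed

lemma surrounded_if_in_triangle:
  assumes ijk: "i < j" "j < k" and t: "t \<notin> {i, j, k}"
    and m: "t < i \<Longrightarrow> monotone4 (ccw p) t i j k" "k < t \<Longrightarrow> monotone4 (ccw p) i j k t"
    and tri: "in_triangle (p t) (p i) (p j) (p k) \<or> in_triangle (p t) (p i) (p k) (p j)"
  shows "surrounded (ccw p) t i j k"
proof -
  define A B C where "A = ori (p t) (p i) (p j)" "B = ori (p t) (p j) (p k)" "C = ori (p t) (p k) (p i)"
  have e: "ori (p i) (p t) (p j) = - A" "ori (p i) (p j) (p t) = A" "ori (p j) (p t) (p k) = - B"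
      "ori (p j) (p k) (p t) = B" "ori (p t) (p i) (p k) = - C" "ori (p i) (p t) (p k) = C"
      "ori (p i) (p k) (p t) = - C" "ori (p k) (p j) (p t) = - B" "ori (p j) (p i) (p t) = - A"
      "ori (p k) (p i) (p t) = C"
    unfolding A_B_C_def by (simp_all add: ori_def algebra_simps)
  have sgn: "0 < A \<and> 0 < B \<and> 0 < C \<or> A < 0 \<and> B < 0 \<and> C < 0"
    using tri unfolding in_triangle_def e by auto
  consider "t < i" | "i < t" "t < j" | "j < t" "t < k" | "k < t" using t by force
  then show ?thesis
  proof cases
    case 1
    have "sign_between (0 \<le> A) (0 \<le> - C) (0 \<le> B)"
      using m(1)[OF 1] unfolding monotone4_def ccw_def e A_B_C_def[symmetric] by blast
    then show ?thesis using sgn by (auto simp: sign_between_def)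
  next
    case 4
    have "sign_between (0 \<le> A) (0 \<le> - C) (0 \<le> B)"
      using m(2)[OF 4] unfolding monotone4_def ccw_def e by blast
    then show ?thesis using sgn by (auto simp: sign_between_def)
  qed (use sgn ijk e in \<open>auto simp: surrounded_def ccw_def\<close>)
qed

definition point_order :: "(nat \<Rightarrow> real^2) \<Rightarrow> nat set \<Rightarrow> bool" where
  "point_order p U \<longleftrightarrow> inj_on p U \<and> general_position (p ` U) \<and>
     (\<forall>a b c d. {a, b, c, d} \<subseteq> U \<and> a < b \<and> b < c \<and> c < d \<longrightarrow> monotone4 (ccw p) a b c d)"

text \<open>
The bridge from geometry to signs: five sorted points that do not span a hole leave a trace among
the signs.
\<close>
lemma obstructed_if_no_hole:
  assumes po: "point_order p (set U)" and H: "{a, b, c, d, e} \<subseteq> set U"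
    and less: "a < b" "b < c" "c < d" "d < e" and no: "\<not> contains_hole 5 (p ` set U)"
  shows "obstructed (ccw p) U a b c d e"
proof (rule ccontr)
  let ?s = "ccw p"
  let ?H = "{a, b, c, d, e}"
  assume nob: "\<not> ?thesis"
  have fan: "\<not> surrounded ?s t a x y" if "t \<in> set U" "x \<in> ?H" "y \<in> ?H" for t x y
  proof
    assume inn: "surrounded ?s t a x y"
    then have "a < x" and "x < y" by (auto simp: surrounded_def)
    with \<open>a < x\<close> have xy: "x \<in> {b, c, d, e}" "y \<in> {b, c, d, e}" using that(2,3) less by auto
    have "x = b \<and> y = c \<or> x = b \<and> y = d \<or> x = b \<and> y = e \<or>
        x = c \<and> y = d \<or> x = c \<and> y = e \<or> x = d \<and> y = e"
      using xy by (elim insertE emptyE) (use \<open>x < y\<close> less in simp_all)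
    then have "obstructed ?s U a b c d e" using inn that(1) unfolding obstructed_def list_ex_iff by blast
    then show False using nob by blast
  qed
  have m: "\<lbrakk>{x, y, z, w} \<subseteq> set U; x < y; y < z; z < w\<rbrakk> \<Longrightarrow> monotone4 ?s x y z w" for x y z w
    using po unfolding point_order_def by blast
  have nin: "\<not> surrounded ?s t i j k" if "t \<in> set U" "i \<in> ?H" "j \<in> ?H" "k \<in> ?H" for t i j k
  proof
    assume inn: "surrounded ?s t i j k"
    then have "i \<noteq> a" using fan that by blast
    then have "a < i" using that less by auto
    have "i \<in> set U" "j \<in> set U" "k \<in> set U" using that(2-4) H by auto
    then have sub: "{a, i, j, k, t} \<subseteq> set U" using that(1) H by simp
    have "surrounded ?s i a j k \<or> surrounded ?s j a i k \<or> surrounded ?s t a i j \<or> surrounded ?s t a i k \<or> surrounded ?s t a j k"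
      by (rule surrounded_via_apex[OF m[OF order_trans[OF _ sub]] \<open>a < i\<close> inn])
    then show False using fan \<open>i \<in> set U\<close> \<open>j \<in> set U\<close> that by blast
  qed
  have "is_hole 5 (p ` set U) (p ` ?H)"
  proof (rule is_hole_if_no_in_triangle)
    show "general_position (p ` set U)" using po by (simp add: point_order_def)
    show "p ` ?H \<subseteq> p ` set U" using H by blast
    have "inj_on p (set U)" using po by (simp add: point_order_def)
    then have "inj_on p ?H" using H by (rule inj_on_subset)
    then show "card (p ` ?H) = 5" using less by (simp add: card_image)
    fix T A B C assume "T \<in> p ` set U" "A \<in> p ` ?H" "B \<in> p ` ?H" "C \<in> p ` ?H"
    then obtain t i j k where t: "T = p t" "t \<in> set U" and ijk: "A = p i" "i \<in> ?H" "B = p j" "j \<in> ?H"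
      "C = p k" "k \<in> ?H" by blast
    have sorted: False if "in_triangle (p t) (p i) (p j) (p k) \<or> in_triangle (p t) (p i) (p k) (p j)"
      "i < j" "j < k" "i \<in> ?H" "j \<in> ?H" "k \<in> ?H" for i j k
    proof -
      have sub: "i \<in> set U" "j \<in> set U" "k \<in> set U" using that H by auto
      have "t \<notin> {i, j, k}" using that(1) by (auto simp: in_triangle_def)
      then have "surrounded ?s t i j k"
        by (rule surrounded_if_in_triangle[OF that(2,3)]) (use m t(2) sub that in auto)
      then show False using nin[OF t(2)] that by blast
    qed
    show "\<not> in_triangle T A B C"
    proof
      assume tri: "in_triangle T A B C"
      then have "i \<noteq> j" "j \<noteq> k" "i \<noteq> k" unfolding ijk by (auto simp: in_triangle_def)
      moreover have "in_triangle (p t) (p j) (p k) (p i)" "in_triangle (p t) (p k) (p i) (p j)"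
        using tri unfolding ijk t in_triangle_def by blast+
      ultimately show False using tri sorted ijk t by (metis linorder_neqE_nat)
    qed
  qed simp
  then show False using no unfolding contains_hole_def by blast
qed

section \<open>Five finite configurations\<close>

definition signotope :: "(nat \<Rightarrow> nat \<Rightarrow> nat \<Rightarrow> bool) \<Rightarrow> nat \<Rightarrow> bool" where
  "signotope s n \<longleftrightarrow> (\<forall>a b c d. a < b \<and> b < c \<and> c < d \<and> d < n \<longrightarrow> monotone4 s a b c d)"

definition pentagon_free :: "(nat \<Rightarrow> nat \<Rightarrow> nat \<Rightarrow> bool) \<Rightarrow> nat list \<Rightarrow> bool" where
  "pentagon_free s U \<longleftrightarrow> (\<forall>a b c d e. {a, b, c, d, e} \<subseteq> set U \<and> a < b \<and> b < c \<and> c < d \<and> d < e \<longrightarrow>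
     obstructed s U a b c d e)"

text \<open>
Quantification over the increasing tuples of an explicit list. Rewriting with the recursion
equations produces the finitely many instances that the propositional refutations need.
\<close>
primrec all_pairs where
  "all_pairs f [] \<longleftrightarrow> True"
| "all_pairs f (x # xs) \<longleftrightarrow> list_all (f x) xs \<and> all_pairs f xs"

primrec all_triples where
  "all_triples f [] \<longleftrightarrow> True"
| "all_triples f (x # xs) \<longleftrightarrow> all_pairs (f x) xs \<and> all_triples f xs"

primrec all_quadruples where
  "all_quadruples f [] \<longleftrightarrow> True"
| "all_quadruples f (x # xs) \<longleftrightarrow> all_triples (f x) xs \<and> all_quadruples f xs"

primrec all_quintuples where
  "all_quintuples f [] \<longleftrightarrow> True"
| "all_quintuples f (x # xs) \<longleftrightarrow> all_quadruples (f x) xs \<and> all_quintuples f xs"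

lemma all_pairsI:
  "sorted_wrt (<) xs \<Longrightarrow> (\<And>a b. a \<in> set xs \<Longrightarrow> b \<in> set xs \<Longrightarrow> a < b \<Longrightarrow> f a b) \<Longrightarrow> all_pairs f xs"
  for xs :: "nat list"
  by (induction xs) (auto simp: list_all_iff)

lemma all_triplesI:
  "sorted_wrt (<) xs \<Longrightarrow>
    (\<And>a b c. {a, b, c} \<subseteq> set xs \<Longrightarrow> a < b \<Longrightarrow> b < c \<Longrightarrow> f a b c) \<Longrightarrow> all_triples f xs"
  for xs :: "nat list"
  by (induction xs) (auto intro!: all_pairsI)

lemma all_quadruplesI:
  "sorted_wrt (<) xs \<Longrightarrow>
    (\<And>a b c d. {a, b, c, d} \<subseteq> set xs \<Longrightarrow> a < b \<Longrightarrow> b < c \<Longrightarrow> c < d \<Longrightarrow> f a b c d) \<Longrightarrow>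
    all_quadruples f xs"
  for xs :: "nat list"
  by (induction xs) (auto intro!: all_triplesI)

lemma all_quintuplesI:
  "sorted_wrt (<) xs \<Longrightarrow>
    (\<And>a b c d e. {a, b, c, d, e} \<subseteq> set xs \<Longrightarrow> a < b \<Longrightarrow> b < c \<Longrightarrow> c < d \<Longrightarrow> d < e \<Longrightarrow> f a b c d e) \<Longrightarrow>
    all_quintuples f xs"
  for xs :: "nat list"
  by (induction xs) (auto intro!: all_quadruplesI)

lemma list_all_expand: "list_all f [] \<longleftrightarrow> True" "list_all f (x # xs) \<longleftrightarrow> f x \<and> list_all f xs"
  by simp_all

lemma list_ex_expand: "list_ex f [] \<longleftrightarrow> False" "list_ex f (x # xs) \<longleftrightarrow> f x \<or> list_ex f xs"
  by simp_all

lemmas expand_tuples = list_all_expand all_pairs.simps all_triples.simps all_quadruples.simps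
  all_quintuples.simps simp_thms

text \<open>
The signotope axiom in clausal form, together with the one direction of \<open>surrounded\<close> that the
refutations use; the predicate itself then serves as a propositional atom, which keeps the clauses
for pentagons short.
\<close>
lemma signotope_clauses:
  assumes "signotope s n" "sorted_wrt (<) xs" "set xs \<subseteq> {..<n}"
  shows "all_quadruples (\<lambda>a b c d.
    (s a b c \<or> \<not> s a b d \<or> s a c d) \<and> (\<not> s a b c \<or> s a b d \<or> \<not> s a c d) \<and>
    (s a b c \<or> \<not> s a b d \<or> s b c d) \<and> (\<not> s a b c \<or> s a b d \<or> \<not> s b c d) \<and>
    (s a b c \<or> \<not> s a c d \<or> s b c d) \<and> (\<not> s a b c \<or> s a c d \<or> \<not> s b c d) \<and>
    (s a b d \<or> \<not> s a c d \<or> s b c d) \<and> (\<not> s a b d \<or> s a c d \<or> \<not> s b c d) \<and>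
    (\<not> surrounded s b a c d \<or> s a b c \<or> s a b d) \<and> (\<not> surrounded s b a c d \<or> \<not> s a b c \<or> \<not> s a b d) \<and>
    (\<not> surrounded s c a b d \<or> s a c d \<or> s b c d) \<and> (\<not> surrounded s c a b d \<or> \<not> s a c d \<or> \<not> s b c d)) xs"
proof (rule all_quadruplesI[OF assms(2)])
  fix a b c d assume "{a, b, c, d} \<subseteq> set xs" and less: "a < b" "b < c" "c < d"
  then have "monotone4 s a b c d" using assms(1,3) by (auto simp: signotope_def)
  moreover have "surrounded s b a c d \<longrightarrow> s a b c \<noteq> s a b d" "surrounded s c a b d \<longrightarrow> s a c d \<noteq> s b c d"
    using less by (auto simp: surrounded_def)
  ultimately show "
    (s a b c \<or> \<not> s a b d \<or> s a c d) \<and> (\<not> s a b c \<or> s a b d \<or> \<not> s a c d) \<and>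
    (s a b c \<or> \<not> s a b d \<or> s b c d) \<and> (\<not> s a b c \<or> s a b d \<or> \<not> s b c d) \<and>
    (s a b c \<or> \<not> s a c d \<or> s b c d) \<and> (\<not> s a b c \<or> s a c d \<or> \<not> s b c d) \<and>
    (s a b d \<or> \<not> s a c d \<or> s b c d) \<and> (\<not> s a b d \<or> s a c d \<or> \<not> s b c d) \<and>
    (\<not> surrounded s b a c d \<or> s a b c \<or> s a b d) \<and> (\<not> surrounded s b a c d \<or> \<not> s a b c \<or> \<not> s a b d) \<and>
    (\<not> surrounded s c a b d \<or> s a c d \<or> s b c d) \<and> (\<not> surrounded s c a b d \<or> \<not> s a c d \<or> \<not> s b c d)"
    unfolding monotone4_def sign_between_def by blast
qed

lemma pentagon_free_clauses:
  "pentagon_free s U \<Longrightarrow> sorted_wrt (<) U \<Longrightarrow> all_quintuples (obstructed s U) U"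
  by (rule all_quintuplesI) (simp_all add: pentagon_free_def)

lemma not_surrounded:
  "t \<le> a \<Longrightarrow> surrounded s t a b c = False" "c \<le> t \<Longrightarrow> surrounded s t a b c = False" "surrounded s t a t c = False"
  by (auto simp: surrounded_def)

text \<open>
When no pentagon is left after the removal of \<open>b\<close> and none after the removal of \<open>c\<close>, every pentagon
uses both points. For a line that touches the set in \<open>b\<close> and \<open>c\<close>, this is the situation just before
and just after the line turns over that edge.
\<close>
lemma hole_meets_edge:
  assumes "pentagon_free s U" "pentagon_free s V" "set U = set W - {b}" "set V = set W - {c}" "sorted_wrt (<) W"
  shows "all_quintuples (\<lambda>v w x y z. (b = v \<or> b = w \<or> b = x \<or> b = y \<or> b = z) \<and>
    (c = v \<or> c = w \<or> c = x \<or> c = y \<or> c = z) \<or> obstructed s W v w x y z) W"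
proof (rule all_quintuplesI[OF assms(5)], rule disjCI)
  fix v w x y z
  assume H: "{v, w, x, y, z} \<subseteq> set W" "v < w" "w < x" "x < y" "y < z" "\<not> obstructed s W v w x y z"
  have "b \<in> {v, w, x, y, z}"
    using assms(1,3) H obstructed_mono[of s U v w x y z W] unfolding pentagon_free_def by blast
  moreover have "c \<in> {v, w, x, y, z}"
    using assms(2,4) H obstructed_mono[of s V v w x y z W] unfolding pentagon_free_def by blast
  ultimately show "(b = v \<or> b = w \<or> b = x \<or> b = y \<or> b = z) \<and> (c = v \<or> c = w \<or> c = x \<or> c = y \<or> c = z)"
    by blast
qed

text \<open>
Ten points whose hull has the edge from \<open>b\<close> to the last point \<open>9\<close>. The bound \<open>2 \<le> b\<close> keeps the edge
disjoint from the hull edge between \<open>0\<close> and \<open>1\<close>, so that the hull is not a triangle.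
\<close>
lemma pentagon_from_tangent_to_last:
  fixes s :: "nat \<Rightarrow> nat \<Rightarrow> nat \<Rightarrow> bool"
  assumes sig: "signotope s 10" and apex: "\<And>i j. 0 < i \<Longrightarrow> i < j \<Longrightarrow> j < 10 \<Longrightarrow> s 0 i j"
    and nh: "pentagon_free s (filter ((\<noteq>) b) [0, 1, 2, 3, 4, 5, 6, 7, 8, 9])" "pentagon_free s [0, 1, 2, 3, 4, 5, 6, 7, 8]"
    and b: "2 \<le> b" "b \<le> 7"
    and tangent: "\<And>x. 0 < x \<Longrightarrow> x < b \<Longrightarrow> s x b 9" "\<And>x. b < x \<Longrightarrow> x < 9 \<Longrightarrow> \<not> s b x 9"
  shows False
proof -
  let ?W = "[0, 1, 2, 3, 4, 5, 6, 7, 8, 9] :: nat list"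
  have "all_quintuples (\<lambda>v w x y z. (b = v \<or> b = w \<or> b = x \<or> b = y \<or> b = z) \<and>
    (9 = v \<or> 9 = w \<or> 9 = x \<or> 9 = y \<or> 9 = z) \<or> obstructed s ?W v w x y z) ?W"
    by (rule hole_meets_edge[OF nh]) auto
  note holes = this[unfolded obstructed_def expand_tuples list_ex_expand,
    simplified not_surrounded rel_simps simp_thms]
  have "sorted_wrt (<) ?W" "set ?W \<subseteq> {..<10}" by auto
  note axioms = signotope_clauses[OF sig this, unfolded expand_tuples]
  have "all_pairs (s 0) [1, 2, 3, 4, 5, 6, 7, 8, 9]"
    by (rule all_pairsI) (use apex in auto)
  note star = this[unfolded expand_tuples]
  have "list_all (\<lambda>v. b = v \<longrightarrow> list_all (\<lambda>x. (x < v \<longrightarrow> s x v 9) \<and> (v < x \<longrightarrow> \<not> s v x 9)) [1, 2, 3, 4, 5, 6, 7, 8]) [2, 3, 4, 5, 6, 7]"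
    using tangent by (auto simp: list_all_iff)
  note supporting = this[unfolded expand_tuples, simplified rel_simps simp_thms]
  have "b = 2 \<or> b = 3 \<or> b = 4 \<or> b = 5 \<or> b = 6 \<or> b = 7" using b by auto
  \<comment> \<open>Equations between \<open>b\<close> and an index are atoms of the clauses, so the false ones must be excluded.\<close>
  moreover have "b \<noteq> 0" "b \<noteq> 1" "b \<noteq> 8" "b \<noteq> 9" using b by auto
  ultimately show False using holes axioms star supporting by sat
qed

text \<open>
The same with the edge ending at \<open>8\<close>. The last point \<open>9\<close> is then a further vertex of the hull, and
\<open>b = 1\<close> is covered as well.
\<close>
lemma pentagon_from_tangent_to_second_last:
  fixes s :: "nat \<Rightarrow> nat \<Rightarrow> nat \<Rightarrow> bool"
  assumes sig: "signotope s 10" and apex: "\<And>i j. 0 < i \<Longrightarrow> i < j \<Longrightarrow> j < 10 \<Longrightarrow> s 0 i j"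
    and nh: "pentagon_free s (filter ((\<noteq>) b) [0, 1, 2, 3, 4, 5, 6, 7, 8, 9])" "pentagon_free s [0, 1, 2, 3, 4, 5, 6, 7, 9]"
    and b: "1 \<le> b" "b \<le> 7"
    and tangent: "\<And>x. 0 < x \<Longrightarrow> x < b \<Longrightarrow> s x b 8" "\<And>x. b < x \<Longrightarrow> x < 8 \<Longrightarrow> \<not> s b x 8"
      "s b 8 9"
  shows False
proof -
  let ?W = "[0, 1, 2, 3, 4, 5, 6, 7, 8, 9] :: nat list"
  have "all_quintuples (\<lambda>v w x y z. (b = v \<or> b = w \<or> b = x \<or> b = y \<or> b = z) \<and>
    (8 = v \<or> 8 = w \<or> 8 = x \<or> 8 = y \<or> 8 = z) \<or> obstructed s ?W v w x y z) ?W"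
    by (rule hole_meets_edge[OF nh]) auto
  note holes = this[unfolded obstructed_def expand_tuples list_ex_expand,
    simplified not_surrounded rel_simps simp_thms]
  have "sorted_wrt (<) ?W" "set ?W \<subseteq> {..<10}" by auto
  note axioms = signotope_clauses[OF sig this, unfolded expand_tuples]
  have "all_pairs (s 0) [1, 2, 3, 4, 5, 6, 7, 8, 9]"
    by (rule all_pairsI) (use apex in auto)
  note star = this[unfolded expand_tuples]
  have "list_all (\<lambda>v. b = v \<longrightarrow> list_all (\<lambda>x. (x < v \<longrightarrow> s x v 8) \<and> (v < x \<and> x < 8 \<longrightarrow> \<not> s v x 8) \<and> (x = 9 \<longrightarrow> s v 8 9)) [1, 2, 3, 4, 5, 6, 7, 9]) [1, 2, 3, 4, 5, 6, 7]"
    using tangent by (auto simp: list_all_iff)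
  note supporting = this[unfolded expand_tuples, simplified rel_simps simp_thms]
  have "b = 1 \<or> b = 2 \<or> b = 3 \<or> b = 4 \<or> b = 5 \<or> b = 6 \<or> b = 7" using b by auto
  \<comment> \<open>Equations between \<open>b\<close> and an index are atoms of the clauses, so the false ones must be excluded.\<close>
  moreover have "b \<noteq> 0" "b \<noteq> 8" "b \<noteq> 9" using b by auto
  ultimately show False using holes axioms star supporting by sat
qed

text \<open>
The remaining three configurations have \<open>b = 1\<close> and \<open>c\<close> last, so that the hull of \<open>0, \<dots>, 7\<close> with the
points \<open>j\<close> and \<open>c\<close> is the triangle \<open>0 1 c\<close>. Here the first two points \<open>8\<close> and \<open>9\<close> beyond \<open>7\<close> enter,
through the set without \<open>0\<close>. In the first configuration \<open>j\<close> is \<open>8\<close> and \<open>c\<close> is \<open>10\<close>.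
\<close>
lemma pentagon_from_corner_tangent_first:
  fixes s :: "nat \<Rightarrow> nat \<Rightarrow> nat \<Rightarrow> bool"
  assumes sig: "signotope s 11" and apex: "\<And>i j. 0 < i \<Longrightarrow> i < j \<Longrightarrow> j < 11 \<Longrightarrow> s 0 i j"
    and nh: "pentagon_free s [1, 2, 3, 4, 5, 6, 7, 8, 9]" "pentagon_free s [0, 1, 2, 3, 4, 5, 6, 7, 8]" "pentagon_free s [0, 2, 3, 4, 5, 6, 7, 8, 10]"
    and left: "\<And>x. x \<in> set [2, 3, 4, 5, 6, 7, 8] \<Longrightarrow> \<not> s 1 x 10" and right: "s 1 9 10"
  shows False
proof -
  let ?W = "[0, 1, 2, 3, 4, 5, 6, 7, 8, 9, 10] :: nat list"
  have h1: "all_quintuples (obstructed s [1, 2, 3, 4, 5, 6, 7, 8, 9]) [1, 2, 3, 4, 5, 6, 7, 8, 9]"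
    by (rule pentagon_free_clauses[OF nh(1)]) simp
  have h2: "all_quintuples (obstructed s [0, 1, 2, 3, 4, 5, 6, 7, 8]) [0, 1, 2, 3, 4, 5, 6, 7, 8]"
    by (rule pentagon_free_clauses[OF nh(2)]) simp
  have h3: "all_quintuples (obstructed s [0, 2, 3, 4, 5, 6, 7, 8, 10]) [0, 2, 3, 4, 5, 6, 7, 8, 10]"
    by (rule pentagon_free_clauses[OF nh(3)]) simp
  note holes = h1[unfolded obstructed_def expand_tuples list_ex_expand, simplified not_surrounded rel_simps simp_thms]
    h2[unfolded obstructed_def expand_tuples list_ex_expand, simplified not_surrounded rel_simps simp_thms]
    h3[unfolded obstructed_def expand_tuples list_ex_expand, simplified not_surrounded rel_simps simp_thms]
  have "sorted_wrt (<) ?W" "set ?W \<subseteq> {..<11}" by auto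
  note axioms = signotope_clauses[OF sig this, unfolded expand_tuples]
  have "all_pairs (s 0) [1, 2, 3, 4, 5, 6, 7, 8, 9, 10]"
    by (rule all_pairsI) (use apex in auto)
  note star = this[unfolded expand_tuples]
  have "list_all (\<lambda>x. \<not> s 1 x 10) [2, 3, 4, 5, 6, 7, 8]"
    using left by (simp add: list_all_iff)
  note supporting = this[unfolded expand_tuples]
  show False using holes axioms star supporting right by sat
qed

text \<open>Here \<open>j\<close> is \<open>9\<close> and \<open>c\<close> is \<open>10\<close>.\<close>
lemma pentagon_from_corner_tangent_second:
  fixes s :: "nat \<Rightarrow> nat \<Rightarrow> nat \<Rightarrow> bool"
  assumes sig: "signotope s 11" and apex: "\<And>i j. 0 < i \<Longrightarrow> i < j \<Longrightarrow> j < 11 \<Longrightarrow> s 0 i j"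
    and nh: "pentagon_free s [1, 2, 3, 4, 5, 6, 7, 8, 9]" "pentagon_free s [0, 1, 2, 3, 4, 5, 6, 7, 9]" "pentagon_free s [0, 2, 3, 4, 5, 6, 7, 9, 10]"
    and left: "\<And>x. x \<in> set [2, 3, 4, 5, 6, 7, 9] \<Longrightarrow> \<not> s 1 x 10" and right: "s 1 8 10"
  shows False
proof -
  let ?W = "[0, 1, 2, 3, 4, 5, 6, 7, 8, 9, 10] :: nat list"
  have h1: "all_quintuples (obstructed s [1, 2, 3, 4, 5, 6, 7, 8, 9]) [1, 2, 3, 4, 5, 6, 7, 8, 9]"
    by (rule pentagon_free_clauses[OF nh(1)]) simp
  have h2: "all_quintuples (obstructed s [0, 1, 2, 3, 4, 5, 6, 7, 9]) [0, 1, 2, 3, 4, 5, 6, 7, 9]"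
    by (rule pentagon_free_clauses[OF nh(2)]) simp
  have h3: "all_quintuples (obstructed s [0, 2, 3, 4, 5, 6, 7, 9, 10]) [0, 2, 3, 4, 5, 6, 7, 9, 10]"
    by (rule pentagon_free_clauses[OF nh(3)]) simp
  note holes = h1[unfolded obstructed_def expand_tuples list_ex_expand, simplified not_surrounded rel_simps simp_thms]
    h2[unfolded obstructed_def expand_tuples list_ex_expand, simplified not_surrounded rel_simps simp_thms]
    h3[unfolded obstructed_def expand_tuples list_ex_expand, simplified not_surrounded rel_simps simp_thms]
  have "sorted_wrt (<) ?W" "set ?W \<subseteq> {..<11}" by auto
  note axioms = signotope_clauses[OF sig this, unfolded expand_tuples]
  have "all_pairs (s 0) [1, 2, 3, 4, 5, 6, 7, 8, 9, 10]"
    by (rule all_pairsI) (use apex in auto)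
  note star = this[unfolded expand_tuples]
  have "list_all (\<lambda>x. \<not> s 1 x 10) [2, 3, 4, 5, 6, 7, 9]"
    using left by (simp add: list_all_iff)
  note supporting = this[unfolded expand_tuples]
  show False using holes axioms star supporting right by sat
qed

text \<open>Here \<open>j\<close> is \<open>10\<close> and \<open>c\<close> is \<open>11\<close>, so that both \<open>8\<close> and \<open>9\<close> lie beyond the tangent.\<close>
lemma pentagon_from_corner_tangent_later:
  fixes s :: "nat \<Rightarrow> nat \<Rightarrow> nat \<Rightarrow> bool"
  assumes sig: "signotope s 12" and apex: "\<And>i j. 0 < i \<Longrightarrow> i < j \<Longrightarrow> j < 12 \<Longrightarrow> s 0 i j"
    and nh: "pentagon_free s [1, 2, 3, 4, 5, 6, 7, 8, 9]" "pentagon_free s [0, 1, 2, 3, 4, 5, 6, 7, 10]" "pentagon_free s [0, 2, 3, 4, 5, 6, 7, 10, 11]"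
    and left: "\<And>x. x \<in> set [2, 3, 4, 5, 6, 7, 10] \<Longrightarrow> \<not> s 1 x 11" and right: "s 1 8 11" "s 1 9 11"
  shows False
proof -
  let ?W = "[0, 1, 2, 3, 4, 5, 6, 7, 8, 9, 10, 11] :: nat list"
  have h1: "all_quintuples (obstructed s [1, 2, 3, 4, 5, 6, 7, 8, 9]) [1, 2, 3, 4, 5, 6, 7, 8, 9]"
    by (rule pentagon_free_clauses[OF nh(1)]) simp
  have h2: "all_quintuples (obstructed s [0, 1, 2, 3, 4, 5, 6, 7, 10]) [0, 1, 2, 3, 4, 5, 6, 7, 10]"
    by (rule pentagon_free_clauses[OF nh(2)]) simp
  have h3: "all_quintuples (obstructed s [0, 2, 3, 4, 5, 6, 7, 10, 11]) [0, 2, 3, 4, 5, 6, 7, 10, 11]"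
    by (rule pentagon_free_clauses[OF nh(3)]) simp
  note holes = h1[unfolded obstructed_def expand_tuples list_ex_expand, simplified not_surrounded rel_simps simp_thms]
    h2[unfolded obstructed_def expand_tuples list_ex_expand, simplified not_surrounded rel_simps simp_thms]
    h3[unfolded obstructed_def expand_tuples list_ex_expand, simplified not_surrounded rel_simps simp_thms]
  have "sorted_wrt (<) ?W" "set ?W \<subseteq> {..<12}" by auto
  note axioms = signotope_clauses[OF sig this, unfolded expand_tuples]
  have "all_pairs (s 0) [1, 2, 3, 4, 5, 6, 7, 8, 9, 10, 11]"
    by (rule all_pairsI) (use apex in auto)
  note star = this[unfolded expand_tuples]
  have "list_all (\<lambda>x. \<not> s 1 x 11) [2, 3, 4, 5, 6, 7, 10]"
    using left by (simp add: list_all_iff)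
  note supporting = this[unfolded expand_tuples]
  show False using holes axioms star supporting right by sat
qed

section \<open>Sorting around an extreme point\<close>

lemma sorted_wrt_exists:
  assumes "finite A" "\<And>x y. x \<in> A \<Longrightarrow> y \<in> A \<Longrightarrow> x \<noteq> y \<Longrightarrow> r x y \<or> r y x"
    and "\<And>x y z. x \<in> A \<Longrightarrow> y \<in> A \<Longrightarrow> z \<in> A \<Longrightarrow> r x y \<Longrightarrow> r y z \<Longrightarrow> r x z"
  shows "\<exists>xs. set xs = A \<and> distinct xs \<and> sorted_wrt r xs"
  using assms
proof (induction A rule: finite_induct)
  case empty
  show ?case by (rule exI[of _ "[]"]) simp
next
  case (insert a A)
  have "\<exists>xs. set xs = A \<and> distinct xs \<and> sorted_wrt r xs"
  proof (rule insert.IH)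
    show "r x y \<or> r y x" if "x \<in> A" "y \<in> A" "x \<noteq> y" for x y
      using insert.prems(1)[of x y] that by simp
    show "r x z" if "x \<in> A" "y \<in> A" "z \<in> A" "r x y" "r y z" for x y z
      using insert.prems(2)[of x y z] that by simp
  qed
  then obtain xs where xs: "set xs = A" "distinct xs" "sorted_wrt r xs" by blast
  let ?ys = "filter (\<lambda>y. r y a) xs @ a # filter (\<lambda>y. \<not> r y a) xs"
  have above: "r a y" if "y \<in> A" "\<not> r y a" for y
    using insert.prems(1)[of a y] insert.hyps that by blast
  then have "r x y" if "x \<in> A" "y \<in> A" "r x a" "\<not> r y a" for x y
    using insert.prems(2)[of x a y] that by blast
  then have "sorted_wrt r ?ys"
    using xs above by (auto simp: sorted_wrt_append sorted_wrt_filter)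
  moreover have "set ?ys = insert a A" "distinct ?ys" using xs insert.hyps by auto
  ultimately show ?case by blast
qed

text \<open>
The lowest point, and among the lowest points the leftmost, sees all others within a half-open
half-plane of directions. There the relation \<open>ori u x y > 0\<close> is transitive and thus sorts the points
by angle.
\<close>
lemma radial_enumeration:
  assumes gp: "general_position S" and card: "card S = n" "n > 0"
  shows "\<exists>p. bij_betw p {..<n} S \<and> (\<forall>i j. 0 < i \<and> i < j \<and> j < n \<longrightarrow> ori (p 0) (p i) (p j) > 0)"
proof -
  have fin: "finite S" and ne: "S \<noteq> {}" using gp card by (auto simp: general_position_def)
  define low where "low = {x \<in> S. \<forall>y\<in>S. x$2 \<le> y$2}"
  have "low \<noteq> {}"
    using ex_min_if_finite[of "(\<lambda>x. x$2) ` S"] fin ne unfolding low_def by (force simp: not_less)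
  moreover have "finite low" using fin by (simp add: low_def)
  ultimately obtain u where u: "u \<in> low" "\<And>y. y \<in> low \<Longrightarrow> u$1 \<le> y$1"
    using ex_min_if_finite[of "(\<lambda>x. x$1) ` low"] by (force simp: not_less)
  have uS: "u \<in> S" using u by (simp add: low_def)
  \<comment> \<open>All directions from \<open>u\<close> have angle in \<open>[0, \<pi>)\<close>.\<close>
  have upper: "x$2 > u$2 \<or> x$2 = u$2 \<and> x$1 > u$1" if "x \<in> S - {u}" for x
  proof -
    have "x$2 \<ge> u$2" using u that by (simp add: low_def)
    moreover have "x$1 > u$1" if "x$2 = u$2"
    proof -
      have "x \<in> low" using u that \<open>x \<in> S - {u}\<close> by (auto simp: low_def)
      moreover have "x$1 \<noteq> u$1"
        using that \<open>x \<in> S - {u}\<close> by (auto simp: vec_eq_iff forall_2)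
      ultimately show ?thesis using u(2)[of x] by simp
    qed
    ultimately show ?thesis by linarith
  qed
  have total: "ori u x y > 0 \<or> ori u y x > 0" if "x \<in> S - {u}" "y \<in> S - {u}" "x \<noteq> y" for x y
    using general_position_ori[OF gp uS, of x y] that ori_swap(1)[of u x y] by auto
  have trans: "ori u x z > 0"
    if S: "x \<in> S - {u}" "y \<in> S - {u}" "z \<in> S - {u}" and o: "ori u x y > 0" "ori u y z > 0" for x y z
  proof -
    \<comment> \<open>The Grassmann-Pluecker relation with one point moved to infinity on the horizontal axis.\<close>
    have id: "ori u x z * (y$2 - u$2) = ori u x y * (z$2 - u$2) + ori u y z * (x$2 - u$2)"
      by (simp add: ori_def algebra_simps)
    have nn: "z$2 - u$2 \<ge> 0" "x$2 - u$2 \<ge> 0" "y$2 - u$2 \<ge> 0" using upper S by force+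
    have y: "y$2 - u$2 > 0"
    proof (rule ccontr)
      assume "\<not> ?thesis"
      then have "y$2 = u$2" "y$1 > u$1" using upper[OF S(2)] by auto
      then have "ori u x y \<le> 0" using nn by (simp add: ori_def)
      then show False using o by simp
    qed
    have "\<not> (x$2 = u$2 \<and> z$2 = u$2)"
    proof
      assume "x$2 = u$2 \<and> z$2 = u$2"
      then have "ori u y z \<le> 0" using upper[OF S(3)] y by (simp add: ori_def)
      then show False using o by simp
    qed
    then have "z$2 - u$2 > 0 \<or> x$2 - u$2 > 0" using nn by auto
    then have "ori u x y * (z$2 - u$2) + ori u y z * (x$2 - u$2) > 0"
      using o nn by (auto intro: add_pos_nonneg add_nonneg_pos)
    then show ?thesis using id y by (metis zero_less_mult_pos2)
  qed
  obtain xs where xs: "set xs = S - {u}" "distinct xs" "sorted_wrt (\<lambda>x y. ori u x y > 0) xs"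
    using sorted_wrt_exists[of "S - {u}" "\<lambda>x y. ori u x y > 0"] fin total trans by blast
  let ?p = "\<lambda>i. (u # xs) ! i"
  have dist: "distinct (u # xs)" and set: "set (u # xs) = S" using xs(1,2) uS by auto
  have len: "length (u # xs) = n" using distinct_card[OF dist] set card(1) by simp
  have "bij_betw ?p {..<n} S"
    by (rule bij_betw_nth[OF dist]) (use len set in auto)
  moreover have "ori (?p 0) (?p i) (?p j) > 0" if "0 < i" "i < j" "j < n" for i j
    using sorted_wrt_nth_less[OF xs(3), of "i - 1" "j - 1"] that len by (simp add: nth_Cons')
  ultimately show ?thesis by blast
qed

section \<open>A line that cuts off nine points with an empty pentagon\<close>

text \<open>
The index sequence \<open>0, \<dots>, k - 1, x, y\<close>: it selects from a long sorted sequence the few points of a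
configuration and numbers them consecutively.
\<close>
definition relabel :: "nat \<Rightarrow> nat \<Rightarrow> nat \<Rightarrow> nat \<Rightarrow> nat" where
  "relabel k x y i = (if i < k then i else if i = k then x else y)"

locale radial_points =
  fixes p :: "nat \<Rightarrow> real^2" and n :: nat
  assumes inj: "inj_on p {..<n}" and gp: "general_position (p ` {..<n})"
    and star: "0 < i \<Longrightarrow> i < j \<Longrightarrow> j < n \<Longrightarrow> ori (p 0) (p i) (p j) > 0"
begin

lemma monotone4_p:
  assumes "a < b" "b < c" "c \<le> d" "d < n"
  shows "monotone4 (ccw p) a b c d"
proof (cases "a = 0")
  case True
  have "ccw p 0 x y" if "0 < x" "x \<le> y" "y < n" for x y
    using star[of x y] that by (cases "x = y") (auto simp: ccw_def)
  then show ?thesis using True assms by (simp add: monotone4_def sign_between_def)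
next
  case False
  show ?thesis
    by (rule monotone4_ccw[of "p 0"]) (use False assms star in \<open>auto simp: le_less\<close>)
qed

text \<open>
The case \<open>x = y\<close> is included. It lets one configuration with distinct points \<open>9\<close> and \<open>10\<close> also
serve when the two are the same point.
\<close>
lemma signotope_relabel:
  assumes "k \<le> x" "x \<le> y" "y < n"
  shows "signotope (ccw (p \<circ> relabel k x y)) (k + 2)"
proof -
  have "monotone4 (ccw p) (relabel k x y a) (relabel k x y b) (relabel k x y c) (relabel k x y d)"
    if "a < b" "b < c" "c < d" "d < k + 2" for a b c d
    by (rule monotone4_p) (use that assms in \<open>auto simp: relabel_def\<close>)
  then show ?thesis by (simp add: signotope_def monotone4_def ccw_def)
qed

lemma pentagon_free_relabel:
  assumes U: "sorted_wrt (\<lambda>i j. relabel k x y i < relabel k x y j) U" "sorted_wrt (<) U"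
    and im: "relabel k x y ` set U = I" "I \<subseteq> {..<n}"
    and no: "\<not> contains_hole 5 (p ` I)"
  shows "pentagon_free (ccw (p \<circ> relabel k x y)) U"
proof -
  let ?f = "relabel k x y"
  have n: "?f ` set U \<subseteq> {..<n}" using im by simp
  have mono: "?f i < ?f j" if ij: "i \<in> set U" "j \<in> set U" "i < j" for i j
  proof -
    obtain a b where ab: "a < length U" "b < length U" "i = U ! a" "j = U ! b"
      using ij by (metis in_set_conv_nth)
    have "a < b"
      using ij(3) ab sorted_wrt_nth_less[OF U(2), of b a] by (metis linorder_neqE_nat order_less_asym order_less_irrefl)
    then show ?thesis using sorted_wrt_nth_less[OF U(1)] ab by blast
  qed
  have "inj_on ?f (set U)"
    by (rule inj_onI) (metis mono linorder_neqE_nat order_less_irrefl)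
  then have "inj_on (p \<circ> ?f) (set U)"
    using inj_on_subset[OF inj n] by (simp add: comp_inj_on)
  moreover have "general_position ((p \<circ> ?f) ` set U)"
    by (rule general_position_subset[OF gp]) (use n in auto)
  moreover have "monotone4 (ccw (p \<circ> ?f)) a b c d"
    if "{a, b, c, d} \<subseteq> set U" "a < b" "b < c" "c < d" for a b c d
  proof -
    have "monotone4 (ccw p) (?f a) (?f b) (?f c) (?f d)"
      by (rule monotone4_p) (use that mono n in \<open>auto simp: less_imp_le\<close>)
    then show ?thesis by (simp add: monotone4_def ccw_def)
  qed
  ultimately have "point_order (p \<circ> ?f) (set U)" unfolding point_order_def by blast
  moreover have "\<not> contains_hole 5 ((p \<circ> ?f) ` set U)" using no im(1) by (metis image_comp)
  ultimately show ?thesis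
    unfolding pentagon_free_def by (intro allI impI, elim conjE) (rule obstructed_if_no_hole)
qed

lemma pentagon_free_relabel_filter:
  assumes xy: "8 \<le> x" "x < y" "y < n" and b: "b < 8"
    and no: "\<not> contains_hole 5 (p ` (insert x (insert y {..<8}) - {b}))"
  shows "pentagon_free (ccw (p \<circ> relabel 8 x y)) (filter ((\<noteq>) b) [0, 1, 2, 3, 4, 5, 6, 7, 8, 9])"
proof -
  let ?W = "[0, 1, 2, 3, 4, 5, 6, 7, 8, 9] :: nat list"
  have W: "set ?W = insert 8 (insert 9 {..<8})" by auto
  have inj: "inj_on (relabel 8 x y) (set ?W)"
    unfolding W using xy by (auto simp: inj_on_def relabel_def)
  have "relabel 8 x y ` (set ?W - {b}) = relabel 8 x y ` set ?W - {b}"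
    using inj_on_image_set_diff[OF inj, of "set ?W" "{b}"] b unfolding W
    by (auto simp: relabel_def)
  moreover have "relabel 8 x y ` set ?W = insert x (insert y {..<8})"
    unfolding W by (force simp: relabel_def)
  moreover have "set (filter ((\<noteq>) b) ?W) = set ?W - {b}" unfolding set_filter by blast
  ultimately have im: "relabel 8 x y ` set (filter ((\<noteq>) b) ?W) = insert x (insert y {..<8}) - {b}"
    by simp
  show ?thesis
  proof (rule pentagon_free_relabel[OF _ _ im _ no])
    show "sorted_wrt (\<lambda>i j. relabel 8 x y i < relabel 8 x y j) (filter ((\<noteq>) b) ?W)"
      by (rule sorted_wrt_filter) (use xy in \<open>simp add: relabel_def\<close>)
    show "sorted_wrt (<) (filter ((\<noteq>) b) ?W)" by (rule sorted_wrt_filter) simp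
  qed (use xy in auto)
qed

lemma star_relabel:
  assumes "k \<le> x" "x \<le> y" "y < n" "0 < k" "0 < i" "i < j" "j < k + 2"
  shows "ccw (p \<circ> relabel k x y) 0 i j"
proof -
  have "relabel k x y 0 = 0" "0 < relabel k x y i" "relabel k x y i \<le> relabel k x y j" "relabel k x y j < n"
    using assms by (auto simp: relabel_def)
  then show ?thesis using star[of "relabel k x y i" "relabel k x y j"]
    by (cases "relabel k x y i = relabel k x y j") (auto simp: ccw_def)
qed

text \<open>
The combinatorial core. The cases are the possible positions of \<open>j\<close> and \<open>c\<close> in the angular order
relative to each other and to \<open>8\<close> and \<open>9\<close>, and within the case \<open>j < c\<close> whether \<open>b = 1\<close>.
\<close>
lemma one_of_three_contains_hole:
  assumes n: "n \<ge> 10"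
    and jc: "j \<in> {8..<n}" "c \<in> {8..<n}" "j \<noteq> c" and b: "b \<in> {1..<8}"
    and left: "\<And>x. x \<in> insert j {..<8} - {b} \<Longrightarrow> ori (p b) (p c) (p x) > 0"
    and right: "\<And>x. x \<in> {8..<n} - {j, c} \<Longrightarrow> ori (p b) (p c) (p x) < 0"
  shows "contains_hole 5 (p ` {1..<10}) \<or> contains_hole 5 (p ` insert j {..<8}) \<or>
    contains_hole 5 (p ` (insert j (insert c {..<8}) - {b}))"
proof (rule ccontr)
  assume "\<not> ?thesis"
  then have no: "\<not> contains_hole 5 (p ` {1..<10})" "\<not> contains_hole 5 (p ` insert j {..<8})"
    "\<not> contains_hole 5 (p ` (insert j (insert c {..<8}) - {b}))" by auto
  have sbc: "ccw p x b c" "\<not> ccw p b x c" "ccw p b c x" if "x \<in> insert j {..<8} - {b}" for x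
  proof -
    have "ori (p x) (p b) (p c) = ori (p b) (p c) (p x)" "ori (p b) (p x) (p c) = - ori (p b) (p c) (p x)"
      by (simp_all add: ori_def algebra_simps)
    then show "ccw p x b c" "\<not> ccw p b x c" "ccw p b c x"
      using left[OF that] by (simp_all add: ccw_def)
  qed
  have sbr: "ccw p b x c" if "x \<in> {8..<n} - {j}" for x
    using right[of x] that by (cases "x = c") (auto simp: ccw_def ori_swap(1)[of "p b" "p x" "p c"])
  have set8: "{..<8::nat} = {0, 1, 2, 3, 4, 5, 6, 7}" by auto
  have set10: "{1..<10::nat} = {1, 2, 3, 4, 5, 6, 7, 8, 9}" by auto
  have b8: "b < 8" "0 < b" using b by auto
  consider "c < j" | "j < c" "b \<noteq> 1" | "j < c" "b = 1" "j = 8" | "j < c" "b = 1" "j = 9" | "j < c" "b = 1" "j \<ge> 10"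
    using jc by force
  then show False
  proof cases
    case 1
    let ?f = "relabel 8 c j"
    let ?s = "ccw (p \<circ> ?f)"
    have im1: "?f ` set [0, 1, 2, 3, 4, 5, 6, 7, 9] = insert j {..<8}"
      by (simp add: relabel_def set8 insert_commute)
    show False
    proof (rule pentagon_from_tangent_to_second_last[of ?s b])
      show "signotope ?s 10" using signotope_relabel[of 8 c j] 1 jc by simp
      show "?s 0 i j'" if "0 < i" "i < j'" "j' < 10" for i j'
        using star_relabel[of 8 c j i j'] that 1 jc by simp
      show "pentagon_free ?s (filter ((\<noteq>) b) [0, 1, 2, 3, 4, 5, 6, 7, 8, 9])"
        by (rule pentagon_free_relabel_filter) (use 1 jc no(3) b8 in \<open>auto simp: insert_commute\<close>)
      show "pentagon_free ?s [0, 1, 2, 3, 4, 5, 6, 7, 9]"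
        by (rule pentagon_free_relabel[OF _ _ im1 _ no(2)]) (use 1 jc in \<open>auto simp: relabel_def\<close>)
      show "1 \<le> b" "b \<le> 7" using b by auto
      show "?s x b 8" if "0 < x" "x < b" for x
        using sbc(1)[of x] that b8 by (simp add: ccw_def relabel_def)
      show "\<not> ?s b x 8" if "b < x" "x < 8" for x
        using sbc(2)[of x] that b8 by (simp add: ccw_def relabel_def)
      show "?s b 8 9" using sbc(3)[of j] jc b8 by (simp add: ccw_def relabel_def)
    qed
  next
    case 2
    let ?f = "relabel 8 j c"
    let ?s = "ccw (p \<circ> ?f)"
    have im1: "?f ` set [0, 1, 2, 3, 4, 5, 6, 7, 8] = insert j {..<8}"
      by (simp add: relabel_def set8 insert_commute)
    show False
    proof (rule pentagon_from_tangent_to_last[of ?s b])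
      show "signotope ?s 10" using signotope_relabel[of 8 j c] 2 jc by simp
      show "?s 0 i j'" if "0 < i" "i < j'" "j' < 10" for i j'
        using star_relabel[of 8 j c i j'] that 2 jc by simp
      show "pentagon_free ?s (filter ((\<noteq>) b) [0, 1, 2, 3, 4, 5, 6, 7, 8, 9])"
        by (rule pentagon_free_relabel_filter) (use 2 jc no(3) b8 in \<open>auto simp: insert_commute\<close>)
      show "pentagon_free ?s [0, 1, 2, 3, 4, 5, 6, 7, 8]"
        by (rule pentagon_free_relabel[OF _ _ im1 _ no(2)]) (use 2 jc in \<open>auto simp: relabel_def\<close>)
      show "2 \<le> b" "b \<le> 7" using b 2 by auto
      show "?s x b 9" if "0 < x" "x < b" for x
        using sbc(1)[of x] that b8 by (simp add: ccw_def relabel_def)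
      show "\<not> ?s b x 9" if "b < x" "x < 9" for x
        using sbc(2)[of "?f x"] that b8 jc by (auto simp: ccw_def relabel_def)
    qed
  next
    case 3
    let ?f = "relabel 9 9 c"
    let ?s = "ccw (p \<circ> ?f)"
    have im1: "?f ` set [1, 2, 3, 4, 5, 6, 7, 8, 9] = {1..<10}"
      unfolding set10 by (auto simp: relabel_def)
    have im2: "?f ` set [0, 1, 2, 3, 4, 5, 6, 7, 8] = insert j {..<8}"
      using 3 by (auto simp: relabel_def set8)
    have im3: "?f ` set [0, 2, 3, 4, 5, 6, 7, 8, 10] = insert j (insert c {..<8}) - {b}"
      using 3 by (auto simp: relabel_def set8)
    show False
    proof (rule pentagon_from_corner_tangent_first[of ?s])
      show "signotope ?s 11" using signotope_relabel[of 9 9 c] 3 jc by simp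
      show "?s 0 i j'" if "0 < i" "i < j'" "j' < 11" for i j'
        using star_relabel[of 9 9 c i j'] that 3 jc by simp
      show "pentagon_free ?s [1, 2, 3, 4, 5, 6, 7, 8, 9]"
        by (rule pentagon_free_relabel[OF _ _ im1 _ no(1)]) (use n in \<open>auto simp: relabel_def\<close>)
      show "pentagon_free ?s [0, 1, 2, 3, 4, 5, 6, 7, 8]"
        by (rule pentagon_free_relabel[OF _ _ im2 _ no(2)]) (use n jc in \<open>auto simp: relabel_def\<close>)
      show "pentagon_free ?s [0, 2, 3, 4, 5, 6, 7, 8, 10]"
        by (rule pentagon_free_relabel[OF _ _ im3 _ no(3)]) (use 3 jc n in \<open>auto simp: relabel_def\<close>)
      show "\<not> ?s 1 x 10" if "x \<in> set [2, 3, 4, 5, 6, 7, 8]" for x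
        using sbc(2)[of x] that 3 by (auto simp: ccw_def relabel_def)
      show "?s 1 9 10" using sbr[of 9] 3 n by (auto simp: ccw_def relabel_def)
    qed
  next
    case 4
    let ?f = "relabel 9 9 c"
    let ?s = "ccw (p \<circ> ?f)"
    have im1: "?f ` set [1, 2, 3, 4, 5, 6, 7, 8, 9] = {1..<10}"
      unfolding set10 by (auto simp: relabel_def)
    have im2: "?f ` set [0, 1, 2, 3, 4, 5, 6, 7, 9] = insert j {..<8}"
      using 4 by (auto simp: relabel_def set8)
    have im3: "?f ` set [0, 2, 3, 4, 5, 6, 7, 9, 10] = insert j (insert c {..<8}) - {b}"
      using 4 by (auto simp: relabel_def set8)
    show False
    proof (rule pentagon_from_corner_tangent_second[of ?s])
      show "signotope ?s 11" using signotope_relabel[of 9 9 c] 4 jc by simp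
      show "?s 0 i j'" if "0 < i" "i < j'" "j' < 11" for i j'
        using star_relabel[of 9 9 c i j'] that 4 jc by simp
      show "pentagon_free ?s [1, 2, 3, 4, 5, 6, 7, 8, 9]"
        by (rule pentagon_free_relabel[OF _ _ im1 _ no(1)]) (use n in \<open>auto simp: relabel_def\<close>)
      show "pentagon_free ?s [0, 1, 2, 3, 4, 5, 6, 7, 9]"
        by (rule pentagon_free_relabel[OF _ _ im2 _ no(2)]) (use n jc in \<open>auto simp: relabel_def\<close>)
      show "pentagon_free ?s [0, 2, 3, 4, 5, 6, 7, 9, 10]"
        by (rule pentagon_free_relabel[OF _ _ im3 _ no(3)]) (use 4 jc n in \<open>auto simp: relabel_def\<close>)
      show "\<not> ?s 1 x 10" if "x \<in> set [2, 3, 4, 5, 6, 7, 9]" for x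
        using sbc(2)[of x] that 4 by (auto simp: ccw_def relabel_def)
      show "?s 1 8 10" using sbr[of 8] 4 n by (auto simp: ccw_def relabel_def)
    qed
  next
    case 5
    let ?f = "relabel 10 j c"
    let ?s = "ccw (p \<circ> ?f)"
    have im1: "?f ` set [1, 2, 3, 4, 5, 6, 7, 8, 9] = {1..<10}"
      unfolding set10 by (auto simp: relabel_def)
    have im2: "?f ` set [0, 1, 2, 3, 4, 5, 6, 7, 10] = insert j {..<8}"
      using 5 by (auto simp: relabel_def set8)
    have im3: "?f ` set [0, 2, 3, 4, 5, 6, 7, 10, 11] = insert j (insert c {..<8}) - {b}"
      using 5 by (auto simp: relabel_def set8)
    show False
    proof (rule pentagon_from_corner_tangent_later[of ?s])
      show "signotope ?s 12" using signotope_relabel[of 10 j c] 5 jc by simp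
      show "?s 0 i j'" if "0 < i" "i < j'" "j' < 12" for i j'
        using star_relabel[of 10 j c i j'] that 5 jc by simp
      show "pentagon_free ?s [1, 2, 3, 4, 5, 6, 7, 8, 9]"
        by (rule pentagon_free_relabel[OF _ _ im1 _ no(1)]) (use n in \<open>auto simp: relabel_def\<close>)
      show "pentagon_free ?s [0, 1, 2, 3, 4, 5, 6, 7, 10]"
        by (rule pentagon_free_relabel[OF _ _ im2 _ no(2)]) (use 5 jc n in \<open>auto simp: relabel_def\<close>)
      show "pentagon_free ?s [0, 2, 3, 4, 5, 6, 7, 10, 11]"
        by (rule pentagon_free_relabel[OF _ _ im3 _ no(3)]) (use 5 jc n in \<open>auto simp: relabel_def\<close>)
      show "\<not> ?s 1 x 11" if "x \<in> set [2, 3, 4, 5, 6, 7, 10]" for x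
        using sbc(2)[of "?f x"] that 5 by (auto simp: ccw_def relabel_def)
      show "?s 1 8 11" using sbr[of 8] 5 n by (auto simp: ccw_def relabel_def)
      show "?s 1 9 11" using sbr[of 9] 5 n by (auto simp: ccw_def relabel_def)
    qed
  qed
qed

text \<open>
It remains to see that the three sets of nine points can be cut off. Each of them is bounded by a
line through two of the points that has all other points on the correct sides, and the two points on
the line can be assigned to either side by a small rotation.
\<close>
lemma nine_cut:
  assumes n: "n \<ge> 10"
  shows "\<exists>I \<subseteq> {..<n}. card I = 9 \<and> separable (p ` I) (p ` ({..<n} - I)) \<and> contains_hole 5 (p ` I)"
proof -
  let ?D = "{..<8::nat}" and ?C = "{8..<n}"
  have gpI: "general_position (p ` I)" if "I \<subseteq> {..<n}" for I
    by (rule general_position_subset[OF gp]) (use that in auto)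
  have star': "ori (p 0) (p j) (p i) < 0" if "0 < i" "i < j" "j < n" for i j
    using star[OF that] ori_swap(1)[of "p 0" "p i" "p j"] by simp
  have p_eq: "p x = p y \<longleftrightarrow> x = y" if "x < n" "y < n" for x y
    using inj that by (auto simp: inj_on_def)
  have sep0: "separable (p ` {1..<10}) (p ` ({..<n} - {1..<10}))"
  proof (rule separable_line_split[where p = "p 9" and q = "p 0" and a = "p 9" and b = "p 0"])
    show "ori (p 9) (p 0) x > 0" if x: "x \<in> p ` {1..<10} - {p 9}" for x
    proof -
      obtain i where "x = p i" "i \<in> {1..<10}" "i \<noteq> 9" using x by blast
      then show ?thesis using star'[of i 9] n ori_swap(2)[of "p 9" "p 0" x] by simp
    qed
    show "ori (p 9) (p 0) x < 0" if x: "x \<in> p ` ({..<n} - {1..<10}) - {p 0}" for x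
    proof -
      obtain i where i: "x = p i" "i \<in> {..<n} - {1..<10}" using x by blast
      moreover have "x \<noteq> p 0" using x by blast
      then have "i \<noteq> 0" using i(1) by metis
      ultimately have "9 < i" "i < n" by auto
      then show ?thesis using star[of 9 i] i ori_swap(2)[of "p 9" "p 0" x] by simp
    qed
  qed (use n p_eq in \<open>auto\<close>)
  have sepDC: "separable (p ` ?D) (p ` ?C)"
  proof (rule separable_line_split[where p = "p 8" and q = "p 0" and a = "p 0" and b = "p 8"])
    show "ori (p 8) (p 0) x > 0" if x: "x \<in> p ` ?D - {p 0}" for x
    proof -
      obtain i where "x = p i" "i < 8" "i \<noteq> 0" using x by auto
      then show ?thesis using star'[of i 8] n ori_swap(2)[of "p 8" "p 0" x] by simp
    qed
    show "ori (p 8) (p 0) x < 0" if x: "x \<in> p ` ?C - {p 8}" for x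
    proof -
      obtain i where i: "x = p i" "i < n" "8 < i" using x by (auto simp: le_less)
      then show ?thesis using star[of 8 i] i ori_swap(2)[of "p 8" "p 0" x] by simp
    qed
  qed (use n p_eq in \<open>auto\<close>)
  have DC: "?D \<union> ?C = {..<n}" using n by auto
  obtain b0 j where b0: "b0 < 8" and j: "j \<in> ?C"
    and tan0: "\<And>x. x \<in> ?D - {b0} \<Longrightarrow> ori (p b0) (p j) (p x) > 0"
      "\<And>x. x \<in> ?C - {j} \<Longrightarrow> ori (p b0) (p j) (p x) < 0"
  proof -
    have "p ` ?D \<noteq> {}" "p ` ?C \<noteq> {}" using n lessThan_empty_iff[of "8::nat"] by auto
    moreover have "general_position (p ` ?D \<union> p ` ?C)" using gp DC by (metis image_Un)
    ultimately obtain B J where BJ: "B \<in> p ` ?D" "J \<in> p ` ?C" "\<And>x. x \<in> p ` ?D - {B} \<Longrightarrow> ori B J x > 0"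
        "\<And>x. x \<in> p ` ?C - {J} \<Longrightarrow> ori B J x < 0"
      using inner_tangent[of "p ` ?D" "p ` ?C"] sepDC by blast
    then obtain b0 j where "B = p b0" "b0 < 8" "J = p j" "j \<in> ?C" by auto
    then show ?thesis using that[of b0 j] BJ(3,4) p_eq n by auto
  qed
  let ?A = "insert j ?D"
  have A: "?A \<union> (?C - {j}) = {..<n}" "?A \<subseteq> {..<n}" using j n by auto
  have sep1: "separable (p ` ?A) (p ` (?C - {j}))"
  proof (rule separable_line_left[of _ _ "p b0" "p j"])
    show "ori (p b0) (p j) x > 0" if x: "x \<in> p ` ?A - {p b0, p j}" for x
    proof -
      obtain i where "x = p i" "i \<in> ?D - {b0}" using x by blast
      then show ?thesis using tan0(1) by simp
    qed
    show "ori (p b0) (p j) x < 0" if x: "x \<in> p ` (?C - {j})" for x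
    proof -
      obtain i where "x = p i" "i \<in> ?C - {j}" using x by blast
      then show ?thesis using tan0(2) by simp
    qed
  qed auto
  obtain b c where bA: "b \<in> ?A" and c: "c \<in> ?C - {j}"
    and tan1: "\<And>x. x \<in> ?A - {b} \<Longrightarrow> ori (p b) (p c) (p x) > 0"
      "\<And>x. x \<in> ?C - {j, c} \<Longrightarrow> ori (p b) (p c) (p x) < 0"
  proof -
    have "general_position (p ` ?A \<union> p ` (?C - {j}))" using gp A by (metis image_Un)
    moreover have "?C - {j} \<noteq> {}"
    proof -
      have "8 \<in> ?C - {j} \<or> 9 \<in> ?C - {j}" using n by auto
      then show ?thesis by blast
    qed
    ultimately obtain B J where BJ: "B \<in> p ` ?A" "J \<in> p ` (?C - {j})"
        "\<And>x. x \<in> p ` ?A - {B} \<Longrightarrow> ori B J x > 0" "\<And>x. x \<in> p ` (?C - {j}) - {J} \<Longrightarrow> ori B J x < 0"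
      using inner_tangent[of "p ` ?A" "p ` (?C - {j})"] sep1 by (metis empty_not_insert image_is_empty)
    then obtain b c where bc: "B = p b" "b \<in> ?A" "J = p c" "c \<in> ?C - {j}" by blast
    show ?thesis
    proof (rule that[OF bc(2,4)])
      show "ori (p b) (p c) (p x) > 0" if "x \<in> ?A - {b}" for x
        using BJ(3)[of "p x"] bc that p_eq[of x b] A by auto
      show "ori (p b) (p c) (p x) < 0" if "x \<in> ?C - {j, c}" for x
        using BJ(4)[of "p x"] bc that p_eq[of x c] by auto
    qed
  qed
  \<comment> \<open>The tangent from \<open>b0\<close> to \<open>j\<close> has \<open>c\<close> on its right, so the line from \<open>j\<close> to \<open>c\<close> would have
     \<open>b0\<close> on its right, not on its left.\<close>
  have "b \<noteq> j"
  proof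
    assume "b = j"
    then have "ori (p j) (p c) (p b0) > 0" using tan1(1)[of b0] b0 j by auto
    then show False using tan0(2)[OF c] ori_rotate[of "p j" "p c" "p b0"] by simp
  qed
  \<comment> \<open>Seen from \<open>p 0\<close>, the point \<open>p 1\<close> comes before \<open>p c\<close>.\<close>
  moreover have "b \<noteq> 0"
  proof
    assume "b = 0"
    then have "ori (p 0) (p c) (p 1) > 0" using tan1(1)[of 1] by auto
    then show False using star'[of 1 c] c by auto
  qed
  ultimately have b: "b \<in> {1..<8}" using bA by auto
  let ?I = "insert j (insert c ?D) - {b}"
  have sep2: "separable (p ` ?I) (p ` ({..<n} - ?I))"
  proof (rule separable_line_split[where p = "p b" and q = "p c" and a = "p c" and b = "p b"])
    show "ori (p b) (p c) x > 0" if x: "x \<in> p ` ?I - {p c}" for x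
    proof -
      obtain i where "x = p i" "i \<in> ?A - {b}" using x by blast
      then show ?thesis using tan1(1) by simp
    qed
    show "ori (p b) (p c) x < 0" if x: "x \<in> p ` ({..<n} - ?I) - {p b}" for x
    proof -
      obtain i where "x = p i" "i < n" "i \<notin> ?I" "i \<noteq> b" using x by auto
      then show ?thesis using tan1(2)[of i] by auto
    qed
  qed (use b c j n p_eq in \<open>auto\<close>)
  have sets: "{1..<10} \<subseteq> {..<n}" "card {1..<10::nat} = 9" "card ?A = 9" "?I \<subseteq> {..<n}" "card ?I = 9"
    using n j c b by (auto simp: card_Diff_singleton_if)
  have diff: "{..<n} - ?A = ?C - {j}" using j by auto
  have "contains_hole 5 (p ` {1..<10}) \<or> contains_hole 5 (p ` ?A) \<or> contains_hole 5 (p ` ?I)"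
    by (rule one_of_three_contains_hole[OF n j _ _ b]) (use c tan1 in auto)
  then show ?thesis
  proof (elim disjE)
    assume "contains_hole 5 (p ` {1..<10})"
    then show ?thesis using sep0 sets by blast
  next
    assume "contains_hole 5 (p ` ?A)"
    then show ?thesis using sep1 sets A(2) unfolding diff[symmetric] by blast
  next
    assume "contains_hole 5 (p ` ?I)"
    then show ?thesis using sep2 sets by blast
  qed
qed

end

theorem theorem3:
  fixes m :: nat and S :: "(real^2) set"
  assumes "m > 0"
    and "general_position S"
    and "card S = 2 * m + 9"
  shows "\<exists>A B C. convex_region A \<and> convex_region B \<and> convex_region C \<and>
           disjnt A B \<and> disjnt A C \<and> disjnt B C \<and> A \<union> B \<union> C = UNIV \<and>
           card (S \<inter> A) = 9 \<and> contains_hole 5 (S \<inter> A) \<and>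
           card (S \<inter> B) = m \<and> card (S \<inter> C) = m"
proof -
  obtain p where bij: "bij_betw p {..<2 * m + 9} S"
    and starS: "\<And>i j. 0 < i \<Longrightarrow> i < j \<Longrightarrow> j < 2 * m + 9 \<Longrightarrow> ori (p 0) (p i) (p j) > 0"
    using radial_enumeration[OF assms(2,3)] by auto
  have injS: "inj_on p {..<2 * m + 9}" and S: "S = p ` {..<2 * m + 9}"
    using bij by (auto simp: bij_betw_def)
  have p_eq: "p x = p y \<longleftrightarrow> x = y" if "x < 2 * m + 9" "y < 2 * m + 9" for x y
    using injS that by (auto simp: inj_on_def)
  let ?n = "m + 9"
  \<comment> \<open>The last \<open>m\<close> points in angular order are the first to be cut off.\<close>
  interpret radial_points p ?n
  proof
    show "inj_on p {..<?n}" using injS by (rule inj_on_subset) auto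
    show "general_position (p ` {..<?n})"
      by (rule general_position_subset[OF assms(2)]) (auto simp: S)
    show "0 < i \<Longrightarrow> i < j \<Longrightarrow> j < ?n \<Longrightarrow> ori (p 0) (p i) (p j) > 0" for i j
      using starS by simp
  qed
  obtain I where I: "I \<subseteq> {..<?n}" "card I = 9" "separable (p ` I) (p ` ({..<?n} - I))" "contains_hole 5 (p ` I)"
    using nine_cut assms(1) by auto
  have "separable (p ` {..<?n}) (p ` {?n..<2 * m + 9})"
  proof (rule separable_line_split[where p = "p ?n" and q = "p 0" and a = "p 0" and b = "p ?n"])
    show "ori (p ?n) (p 0) x > 0" if x: "x \<in> p ` {..<?n} - {p 0}" for x
    proof -
      obtain i where "x = p i" "i < ?n" "i \<noteq> 0" using x by auto
      then show ?thesis using starS[of i ?n] assms(1) ori_rotate[of "p 0" "p i" "p ?n"] by simp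
    qed
    show "ori (p ?n) (p 0) x < 0" if x: "x \<in> p ` {?n..<2 * m + 9} - {p ?n}" for x
    proof -
      obtain i where i: "x = p i" "i < 2 * m + 9" "?n < i" using x by (auto simp: le_less)
      then show ?thesis using starS[of ?n i] ori_swap(2)[of "p ?n" "p 0" x] by simp
    qed
  qed (use assms(1) p_eq in auto)
  then obtain v t where vt: "\<forall>x\<in>p ` {..<?n}. v \<bullet> x > t" "\<forall>x\<in>p ` {?n..<2 * m + 9}. v \<bullet> x < t"
    unfolding separable_def by blast
  have v: "v \<bullet> p i > t" if "i < ?n" for i using vt(1) that by simp
  have v': "v \<bullet> p i < t" if "?n \<le> i" "i < 2 * m + 9" for i using vt(2) that by simp
  obtain w r where wr: "\<forall>x\<in>p ` I. w \<bullet> x > r" "\<forall>x\<in>p ` ({..<?n} - I). w \<bullet> x < r"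
    using I(3) unfolding separable_def by blast
  have w: "w \<bullet> p i > r" if "i \<in> I" for i using wr(1) that by simp
  have w': "w \<bullet> p i < r" if "i < ?n" "i \<notin> I" for i using wr(2) that by simp
  define A where "A = {x. v \<bullet> x > t} \<inter> {x. w \<bullet> x > r}"
  define B where "B = {x. v \<bullet> x > t} \<inter> {x. w \<bullet> x \<le> r}"
  define C where "C = {x. v \<bullet> x \<le> t}"
  have SA: "S \<inter> A = p ` I" and SB: "S \<inter> B = p ` ({..<?n} - I)" and SC: "S \<inter> C = p ` {?n..<2 * m + 9}"
  proof -
    have cases: "i < ?n \<and> v \<bullet> p i > t \<and> (i \<in> I \<and> w \<bullet> p i > r \<or> i \<notin> I \<and> w \<bullet> p i < r) \<or>
        \<not> i < ?n \<and> i \<notin> I \<and> v \<bullet> p i < t" if "i < 2 * m + 9" for i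
      using v[of i] v'[of i] w[of i] w'[of i] I(1) that by (cases "i < ?n"; cases "i \<in> I") auto
    have mem: "p i \<in> A \<longleftrightarrow> i \<in> I" "p i \<in> B \<longleftrightarrow> i < ?n \<and> i \<notin> I" "p i \<in> C \<longleftrightarrow> \<not> i < ?n"
      if "i < 2 * m + 9" for i
      using cases[OF that] I(1) unfolding A_def B_def C_def by auto
    have S_Int: "S \<inter> R = p ` {i \<in> {..<2 * m + 9}. p i \<in> R}" for R
      unfolding S by blast
    have "{i \<in> {..<2 * m + 9}. p i \<in> A} = I" using mem(1) I(1) by auto
    then show "S \<inter> A = p ` I" using S_Int[of A] by simp
    have "{i \<in> {..<2 * m + 9}. p i \<in> B} = {..<?n} - I" using mem(2) by auto
    then show "S \<inter> B = p ` ({..<?n} - I)" using S_Int[of B] by simp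
    have "{i \<in> {..<2 * m + 9}. p i \<in> C} = {?n..<2 * m + 9}" using mem(3) by auto
    then show "S \<inter> C = p ` {?n..<2 * m + 9}" using S_Int[of C] by simp
  qed
  have card_p: "card (p ` J) = card J" if "J \<subseteq> {..<2 * m + 9}" for J
    using injS that by (meson card_image inj_on_subset)
  have cards: "card (S \<inter> A) = 9" "card (S \<inter> B) = m" "card (S \<inter> C) = m"
  proof -
    have "I \<subseteq> {..<2 * m + 9}" using I(1) by auto
    then show "card (S \<inter> A) = 9" using SA card_p I(2) by simp
    have "card ({..<?n} - I) = m" using I(1,2) by (simp add: card_Diff_subset finite_subset)
    moreover have "{..<?n} - I \<subseteq> {..<2 * m + 9}" by auto
    ultimately show "card (S \<inter> B) = m" using SB card_p[of "{..<?n} - I"] by simp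
    have "{?n..<2 * m + 9} \<subseteq> {..<2 * m + 9}" by auto
    then show "card (S \<inter> C) = m" using SC card_p[of "{?n..<2 * m + 9}"] by simp
  qed
  have region: "convex_region R" if "convex R" "open U" "U \<subseteq> R" "x \<in> U" for R U x
    using that interior_maximal[of U R] unfolding convex_region_def by blast
  obtain i where "i \<in> I" using I(2) by fastforce
  have regA: "convex_region A"
  proof (rule region)
    show "convex A" unfolding A_def by (intro convex_Int convex_halfspace_gt)
    show "open A" unfolding A_def by (intro open_Int open_halfspace_gt)
    show "A \<subseteq> A" by simp
    show "p i \<in> A" using \<open>i \<in> I\<close> SA by blast
  qed
  have "{..<?n} - I \<noteq> {}"
  proof
    assume "{..<?n} - I = {}"
    then have "S \<inter> B = {}" using SB by simp
    then show False using cards(2) assms(1) by simp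
  qed
  then obtain k where k: "k < ?n" "k \<notin> I" by auto
  have regB: "convex_region B"
  proof (rule region)
    show "convex B" unfolding B_def by (intro convex_Int convex_halfspace_gt convex_halfspace_le)
    show "open ({x. v \<bullet> x > t} \<inter> {x. w \<bullet> x < r})"
      by (intro open_Int open_halfspace_gt open_halfspace_lt)
    show "{x. v \<bullet> x > t} \<inter> {x. w \<bullet> x < r} \<subseteq> B" unfolding B_def by auto
    show "p k \<in> {x. v \<bullet> x > t} \<inter> {x. w \<bullet> x < r}" using v w' k by simp
  qed
  have "convex_region C"
  proof (rule region)
    show "convex C" unfolding C_def by (rule convex_halfspace_le)
    show "open {x. v \<bullet> x < t}" by (rule open_halfspace_lt)
    show "{x. v \<bullet> x < t} \<subseteq> C" unfolding C_def by auto
    show "p ?n \<in> {x. v \<bullet> x < t}" using v'[of ?n] assms(1) by simp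
  qed
  moreover have "disjnt A B" "disjnt A C" "disjnt B C" "A \<union> B \<union> C = UNIV"
    unfolding A_def B_def C_def disjnt_def by auto
  ultimately show ?thesis using regA regB cards SA I(4) by metis
qed

end
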